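(* Let $m\ge 1$ be an integer and let $\delta>0$ be real. For each of the preferential attachment models (a), (b), (c), there exists a constant $c_2=c_2(m,\delta)>0$ such that, with high probability as $t\to\infty$, the diameter of $G_{m,\delta}(t)$ is at least $c_2\log t$.
   Context: Preferential attachment models. For an integer $m\ge1$ and a real $\delta\ge -m$, $G_{m,\delta}(t)$ is a random multigraph with vertex set $[t]=\{1,\dots,t\}$ and $mt$ edges. $D_i(t)$ denotes the degree of vertex $i$ at time $t$ (a self-loop adds 2 to the degree). Model (a), $m=1$: $G_{1,\delta}(1)$ is one vertex with one self-loop. Given $G_{1,\delta}(t)$, a vertex $t+1$ with a single edge is added; the other end point of the edge is $t+1$ itself with probability $\frac{1+\delta}{t(2+\delta)+(1+\delta)}$, and is $i\in[t]$ with probability $\frac{D_i(t)+\delta}{t(2+\delta)+(1+\delta)}$. For $m>1$: put $\delta'=\delta/m$, take $G_{1,\delta'}(mt)$, and for each $1\le j\le t$ merge its vertices $(j-1)m+1,\dots,jm$ into the single vertex $j$ of $G_{m,\delta}(t)$ (keeping all edges). Model (b), $m=1$: start from $G_{1,\delta}(2)$, consisting of vertices $1,2$ joined by 2 edges. For $t\ge2$, given $G_{1,\delta}(t)$, vertex $t+1$ with a single edge is added, attached to $i\in[t]$ with probability $\frac{D_i(t)+\delta}{t(2+\delta)}$. For $m>1$, $G_{m,\delta}(t)$ is obtained from $G_{1,\delta/m}(mt)$ by the same merging as in model (a). Model (c), $m\ge1$: start from $G_{m,\delta}(2)$, consisting of vertices $1,2$ joined by $2m$ edges. For $t\ge2$,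 given $G_{m,\delta}(t)$, vertex $t+1$ is added with $m$ edges whose other end points are chosen independently, each equal to $i\in[t]$ with probability $\frac{D_i(t)+\delta}{t(2m+\delta)}$. Diameter: $\mathrm{diam}(G)=\max\{\mathrm{dist}_G(i,j): i,j\in G,\ \mathrm{dist}_G(i,j)<\infty\}$, with $\mathrm{dist}_G$ the graph distance. A sequence of events $A_t$ occurs with high probability if $\mathbb P(A_t)\to1$ as $t\to\infty$. *)

theory Defs
  imports "HOL-Probability.Probability" "HOL-Library.Uprod" "HOL-Library.Extended_Nat"
begin

section \<open>Finite undirected multigraphs with loops\<close>

datatype 'a multigraph = Multigraph (verts: "'a set") (edges: "'a uprod multiset")

text \<open>A loop at \<open>i\<close> is counted by both summands, hence contributes 2.\<close>
definition vdegree :: "'a multigraph \<Rightarrow> 'a \<Rightarrow> nat" where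
  "vdegree G i = size {#e \<in># edges G. i \<in> set_uprod e#} + count (edges G) (Upair i i)"

definition walk :: "'a multigraph \<Rightarrow> 'a list \<Rightarrow> bool" where
  "walk G p \<longleftrightarrow> p \<noteq> [] \<and> set p \<subseteq> verts G \<and> successively (\<lambda>u v. Upair u v \<in># edges G) p"

definition gdist :: "'a multigraph \<Rightarrow> 'a \<Rightarrow> 'a \<Rightarrow> enat" where
  "gdist G i j = (INF p \<in> {p. walk G p \<and> hd p = i \<and> last p = j}. enat (length p - 1))"

text \<open>Only pairs at finite distance (vertices of the same component) enter the maximum.\<close>
definition diam :: "'a multigraph \<Rightarrow> nat" where
  "diam G = Max {the_enat (gdist G i j) | i j. i \<in> verts G \<and> j \<in> verts G \<and> gdist G i j < \<infinity>}"

definition add_vertex :: "'a \<Rightarrow> 'a list \<Rightarrow> 'a multigraph \<Rightarrow> 'a multigraph" where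
  "add_vertex v us G =
     Multigraph (insert v (verts G)) (edges G + mset (map (Upair v) us))"

text \<open>\<open>block m v = \<lceil>v / m\<rceil>\<close>: the vertices \<open>(j - 1) m + 1, \<dots>, j m\<close> form block \<open>j\<close>.\<close>
definition block :: "nat \<Rightarrow> nat \<Rightarrow> nat" where
  "block m v = (v + m - 1) div m"

definition merge_blocks :: "nat \<Rightarrow> nat multigraph \<Rightarrow> nat multigraph" where
  "merge_blocks m G = Multigraph (block m ` verts G) (image_mset (map_uprod (block m)) (edges G))"

lemma block_eq_iff:
  assumes "m \<ge> 1" "j \<ge> 1"
  shows "block m v = j \<longleftrightarrow> (j - 1) * m + 1 \<le> v \<and> v \<le> j * m"
proof -
  obtain k where j: "j = Suc k" using assms(2) by (cases j) auto
  have "block m v = j \<longleftrightarrow> j * m \<le> v + m - 1 \<and> v + m - 1 < Suc j * m"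
    using assms(1) less_eq_div_iff_mult_less_eq[of m j "v + m - 1"]
      div_less_iff_less_mult[of m "v + m - 1" "Suc j"]
    by (auto simp: block_def)
  then show ?thesis using assms(1) by (auto simp: j)
qed

lemma merge_blocks_1: "merge_blocks 1 G = G"
proof -
  have "block 1 = id" by (auto simp: block_def)
  then show ?thesis by (simp add: merge_blocks_def uprod.map_id0)
qed


section \<open>The three preferential attachment models\<close>

text \<open>
  The models are given by the law of the graph at time \<open>t\<close>. Times before the initial time
  (1 in model (a), 2 in models (b) and (c)) carry the initial graph, by convention.
  The weights passed to \<^const>\<open>embed_pmf\<close> are shown below to be probability weights
  along the process whenever \<open>\<delta> \<ge> - m\<close>.
\<close>

definition attach_or_loop :: "real \<Rightarrow> nat \<Rightarrow> nat multigraph \<Rightarrow> nat pmf" where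
  "attach_or_loop \<delta> t G = embed_pmf (\<lambda>i.
     if i \<in> {1..t} then (real (vdegree G i) + \<delta>) / (real t * (2 + \<delta>) + (1 + \<delta>))
     else if i = t + 1 then (1 + \<delta>) / (real t * (2 + \<delta>) + (1 + \<delta>))
     else 0)"

definition attach :: "nat \<Rightarrow> real \<Rightarrow> nat \<Rightarrow> nat multigraph \<Rightarrow> nat pmf" where
  "attach m \<delta> t G = embed_pmf (\<lambda>i.
     if i \<in> {1..t} then (real (vdegree G i) + \<delta>) / (real t * (2 * real m + \<delta>)) else 0)"

primrec PA_a1 :: "real \<Rightarrow> nat \<Rightarrow> nat multigraph pmf" where
  "PA_a1 \<delta> 0 = return_pmf (Multigraph {1} {#Upair 1 1#})"
| "PA_a1 \<delta> (Suc t) =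
     (if t < 1 then return_pmf (Multigraph {1} {#Upair 1 1#})
      else do {
        G \<leftarrow> PA_a1 \<delta> t;
        i \<leftarrow> attach_or_loop \<delta> t G;
        return_pmf (add_vertex (t + 1) [i] G)
      })"

definition PA_a :: "nat \<Rightarrow> real \<Rightarrow> nat \<Rightarrow> nat multigraph pmf" where
  "PA_a m \<delta> t = map_pmf (merge_blocks m) (PA_a1 (\<delta> / real m) (m * t))"

primrec PA_b1 :: "real \<Rightarrow> nat \<Rightarrow> nat multigraph pmf" where
  "PA_b1 \<delta> 0 = return_pmf (Multigraph {1, 2} {#Upair 1 2, Upair 1 2#})"
| "PA_b1 \<delta> (Suc t) =
     (if t < 2 then return_pmf (Multigraph {1, 2} {#Upair 1 2, Upair 1 2#})
      else do {
        G \<leftarrow> PA_b1 \<delta> t;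
        i \<leftarrow> attach 1 \<delta> t G;
        return_pmf (add_vertex (t + 1) [i] G)
      })"

definition PA_b :: "nat \<Rightarrow> real \<Rightarrow> nat \<Rightarrow> nat multigraph pmf" where
  "PA_b m \<delta> t = map_pmf (merge_blocks m) (PA_b1 (\<delta> / real m) (m * t))"

primrec PA_c :: "nat \<Rightarrow> real \<Rightarrow> nat \<Rightarrow> nat multigraph pmf" where
  "PA_c m \<delta> 0 = return_pmf (Multigraph {1, 2} (replicate_mset (2 * m) (Upair 1 2)))"
| "PA_c m \<delta> (Suc t) =
     (if t < 2 then return_pmf (Multigraph {1, 2} (replicate_mset (2 * m) (Upair 1 2)))
      else do {
        G \<leftarrow> PA_c m \<delta> t;
        us \<leftarrow> replicate_pmf m (attach m \<delta> t G);
        return_pmf (add_vertex (t + 1) us G)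
      })"

text \<open>\<open>\<P>(\<E>\<^sub>t) \<rightarrow> 1\<close>; this depends only on the law of the graph at each single time.\<close>
definition with_high_probability :: "(nat \<Rightarrow> 'a pmf) \<Rightarrow> (nat \<Rightarrow> 'a \<Rightarrow> bool) \<Rightarrow> bool" where
  "with_high_probability P E \<longleftrightarrow>
     (\<lambda>t. measure_pmf.prob (P t) {G. E t G}) \<longlonglongrightarrow> 1"


section \<open>The attachment weights are probability weights\<close>

definition pa_graph :: "nat \<Rightarrow> nat \<Rightarrow> nat multigraph \<Rightarrow> bool" where
  "pa_graph m t G \<longleftrightarrow> verts G = {1..t} \<and> (\<forall>e\<in>#edges G. set_uprod e \<subseteq> {1..t}) \<and>
     size (edges G) = m * t \<and> (\<forall>i\<in>{1..t}. m \<le> vdegree G i)"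

lemma sum_size_filter_mem:
  assumes "finite V" "\<forall>e\<in>#E. set_uprod e \<subseteq> V"
  shows "(\<Sum>i\<in>V. size {#e \<in># E. i \<in> set_uprod e#} + count E (Upair i i)) = 2 * size E"
  using assms(2)
proof (induction E)
  case empty
  then show ?case by simp
next
  case (add e E)
  obtain x y where e: "e = Upair x y" by (cases e) auto
  have xy: "x \<in> V" "y \<in> V" using add.prems by (auto simp: e)
  have "(\<Sum>i\<in>V. size {#f \<in># add_mset e E. i \<in> set_uprod f#} + count (add_mset e E) (Upair i i))
      = (\<Sum>i\<in>V. (size {#f \<in># E. i \<in> set_uprod f#} + count E (Upair i i))
             + ((if i = x then 1 else 0) + (if i = y then 1 else 0)))"
    by (intro sum.cong) (auto simp: e)
  also have "\<dots> = 2 * size E + ((\<Sum>i\<in>V. if i = x then 1 else 0) + (\<Sum>i\<in>V. if i = y then 1 else 0))"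
    using add by (simp add: sum.distrib)
  also have "\<dots> = 2 * size (add_mset e E)"
    using xy assms(1) by (simp add: sum.delta)
  finally show ?case .
qed

lemma sum_vdegree:
  assumes "pa_graph m t G"
  shows "(\<Sum>i\<in>{1..t}. real (vdegree G i)) = 2 * real m * real t"
proof -
  have "(\<Sum>i\<in>{1..t}. vdegree G i) = 2 * (m * t)"
    using sum_size_filter_mem[of "{1..t}" "edges G"] assms by (simp add: vdegree_def pa_graph_def)
  then show ?thesis by (metis of_nat_mult of_nat_numeral of_nat_sum mult.assoc)
qed

lemma pmf_embed_finite:
  fixes f :: "'a \<Rightarrow> real"
  assumes "finite A" "\<And>x. 0 \<le> f x" "\<And>x. x \<notin> A \<Longrightarrow> f x = 0" "sum f A = 1"
  shows "pmf (embed_pmf f) x = f x"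
proof (rule pmf_embed_pmf)
  have "(\<integral>\<^sup>+x. ennreal (f x) \<partial>count_space UNIV) = (\<Sum>x\<in>A. ennreal (f x))"
    using assms(1,3) by (intro nn_integral_count_space') auto
  also have "\<dots> = 1" using assms by (simp add: sum_ennreal)
  finally show "(\<integral>\<^sup>+x. ennreal (f x) \<partial>count_space UNIV) = 1" .
qed (use assms in auto)

lemma pmf_attach:
  assumes "pa_graph m t G" "m \<ge> 1" "t \<ge> 1" "\<delta> \<ge> - real m"
  shows "pmf (attach m \<delta> t G) i =
    (if i \<in> {1..t} then (real (vdegree G i) + \<delta>) / (real t * (2 * real m + \<delta>)) else 0)"
  unfolding attach_def
proof (rule pmf_embed_finite[where A = "{1..t}"])
  have pos: "real t * (2 * real m + \<delta>) > 0" using assms by simp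
  have ge: "real (vdegree G i) + \<delta> \<ge> 0" if "i \<in> {1..t}" for i
  proof -
    have "real m \<le> real (vdegree G i)" using assms(1) that by (simp add: pa_graph_def)
    then show ?thesis using assms(4) by linarith
  qed
  show "0 \<le> (if i \<in> {1..t} then (real (vdegree G i) + \<delta>) / (real t * (2 * real m + \<delta>)) else 0)" for i
    using ge[of i] pos by auto
  have "(\<Sum>i\<in>{1..t}. real (vdegree G i) + \<delta>) = real t * (2 * real m + \<delta>)"
    using sum_vdegree[OF assms(1)] by (simp add: sum.distrib algebra_simps)
  then show "(\<Sum>i\<in>{1..t}. if i \<in> {1..t}
      then (real (vdegree G i) + \<delta>) / (real t * (2 * real m + \<delta>)) else 0) = 1"
    using less_imp_neq[OF pos] by (simp add: sum_divide_distrib[symmetric])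
qed auto

lemma pmf_attach_or_loop:
  assumes "pa_graph 1 t G" "t \<ge> 1" "\<delta> \<ge> - 1"
  shows "pmf (attach_or_loop \<delta> t G) i =
    (if i \<in> {1..t} then (real (vdegree G i) + \<delta>) / (real t * (2 + \<delta>) + (1 + \<delta>))
     else if i = t + 1 then (1 + \<delta>) / (real t * (2 + \<delta>) + (1 + \<delta>))
     else 0)"
  unfolding attach_or_loop_def
proof (rule pmf_embed_finite[where A = "insert (t + 1) {1..t}"])
  let ?Z = "real t * (2 + \<delta>) + (1 + \<delta>)"
  let ?f = "\<lambda>i. if i \<in> {1..t} then (real (vdegree G i) + \<delta>) / ?Z
     else if i = t + 1 then (1 + \<delta>) / ?Z else 0"
  have "real t * (2 + \<delta>) > 0" using assms by simp
  then have pos: "?Z > 0" using assms by linarith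
  have ge: "real (vdegree G i) + \<delta> \<ge> 0" if "i \<in> {1..t}" for i
  proof -
    have "1 \<le> real (vdegree G i)" using assms(1) that by (simp add: pa_graph_def)
    then show ?thesis using assms(3) by linarith
  qed
  show "0 \<le> ?f i" for i
    using ge[of i] pos assms(3) by auto
  have *: "(\<Sum>i\<in>{1..t}. real (vdegree G i) + \<delta>) = real t * (2 + \<delta>)"
    using sum_vdegree[OF assms(1)] by (simp add: sum.distrib algebra_simps)
  have "sum ?f (insert (t + 1) {1..t}) = (1 + \<delta>) / ?Z + (\<Sum>i\<in>{1..t}. (real (vdegree G i) + \<delta>) / ?Z)"
    by (subst sum.insert) auto
  also have "\<dots> = (1 + \<delta>) / ?Z + real t * (2 + \<delta>) / ?Z"
    by (simp only: sum_divide_distrib[symmetric] *)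
  also have "\<dots> = 1" using pos by (simp add: add_divide_distrib[symmetric] add.commute)
  finally show "sum ?f (insert (t + 1) {1..t}) = 1" .
qed auto

lemma pa_graph_add_vertex:
  assumes G: "pa_graph m t G" and us: "length us = m" "set us \<subseteq> {1..t + 1}"
  shows "pa_graph m (t + 1) (add_vertex (t + 1) us G)"
proof -
  have "m \<le> vdegree (add_vertex (t + 1) us G) i" if i: "i \<in> {1..t + 1}" for i
  proof (cases "i = t + 1")
    case True
    have "{#e \<in># mset (map (Upair i) us). i \<in> set_uprod e#} = mset (map (Upair i) us)"
      by (induction us) auto
    then have "size {#e \<in># mset (map (Upair i) us). i \<in> set_uprod e#} = m"
      using us(1) by (simp del: mset_map)
    then show ?thesis unfolding vdegree_def add_vertex_def True by (simp del: mset_map)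
  next
    case False
    then have "m \<le> vdegree G i" using G i by (auto simp: pa_graph_def)
    then show ?thesis by (simp add: vdegree_def add_vertex_def)
  qed
  moreover have "set_uprod e \<subseteq> {1..t + 1}" if "e \<in># edges (add_vertex (t + 1) us G)" for e
    using that G us(2) by (fastforce simp: add_vertex_def pa_graph_def)
  moreover have "verts (add_vertex (t + 1) us G) = {1..t + 1}"
    using G by (auto simp: add_vertex_def pa_graph_def)
  ultimately show ?thesis using G us(1) by (auto simp: pa_graph_def add_vertex_def)
qed

lemma atLeastAtMost_1_2: "{1..2::nat} = {1, 2}"
  by auto

lemma pa_graph_PA_c:
  assumes "m \<ge> 1" "\<delta> \<ge> - real m" "t \<ge> 2" "G \<in> set_pmf (PA_c m \<delta> t)"
  shows "pa_graph m t G"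
  using assms(3,4)
proof (induction t arbitrary: G rule: dec_induct)
  case base
  then have G: "G = Multigraph {1, 2} (replicate_mset (2 * m) (Upair 1 2))"
    by (simp add: numeral_2_eq_2)
  have "{#e \<in># replicate_mset n (Upair 1 2). i \<in> set_uprod e#} = replicate_mset n (Upair 1 2)"
    if "i \<in> {1, 2}" for i n :: nat
    using that by (induction n) auto
  then show ?case
    by (simp add: G pa_graph_def vdegree_def atLeastAtMost_1_2 del: One_nat_def)
next
  case (step t)
  then obtain H us where H: "H \<in> set_pmf (PA_c m \<delta> t)"
    and us: "us \<in> set_pmf (replicate_pmf m (attach m \<delta> t H))"
    and G: "G = add_vertex (t + 1) us H" by auto
  have inv: "pa_graph m t H" using step.IH H .
  have "set_pmf (attach m \<delta> t H) \<subseteq> {1..t}"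
    using pmf_attach[OF inv assms(1) _ assms(2)] step.hyps
    by (auto simp: set_pmf_eq split: if_splits)
  then have "length us = m" "set us \<subseteq> {1..t + 1}"
    using us by (auto simp: set_replicate_pmf in_lists_conv_set)
  then show ?case using pa_graph_add_vertex[OF inv] G by simp
qed

lemma pa_graph_PA_b1:
  assumes "\<delta> \<ge> - 1" "t \<ge> 2" "G \<in> set_pmf (PA_b1 \<delta> t)"
  shows "pa_graph 1 t G"
proof -
  have "PA_b1 \<delta> s = PA_c 1 \<delta> s" for s
    by (induction s)
      (auto simp: replicate_pmf_1[unfolded One_nat_def] map_pmf_def bind_assoc_pmf
        bind_return_pmf numeral_2_eq_2)
  then show ?thesis using pa_graph_PA_c[of 1 \<delta> t G] assms by simp
qed

lemma pa_graph_PA_a1: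
  assumes "\<delta> \<ge> - 1" "t \<ge> 1" "G \<in> set_pmf (PA_a1 \<delta> t)"
  shows "pa_graph 1 t G"
  using assms(2,3)
proof (induction t arbitrary: G rule: dec_induct)
  case base
  then show ?case by (auto simp: pa_graph_def vdegree_def)
next
  case (step t)
  then obtain H i where H: "H \<in> set_pmf (PA_a1 \<delta> t)"
    and i: "i \<in> set_pmf (attach_or_loop \<delta> t H)"
    and G: "G = add_vertex (t + 1) [i] H" by auto
  have inv: "pa_graph 1 t H" using step.IH H .
  have "i \<in> {1..t + 1}"
    using i pmf_attach_or_loop[OF inv step.hyps(1) assms(1)]
    by (auto simp: set_pmf_eq split: if_splits)
  then show ?case using pa_graph_add_vertex[OF inv, of "[i]"] G by simp
qed

end

theory Submission
  imports Defs "HOL-Analysis.Harmonic_Numbers" "HOL-Real_Asymp.Real_Asymp"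
begin

text \<open>
  All three models are generated by a list of draws, the \<open>n\<close>-th of which picks a target with
  probability at most \<open>\<gamma> (W + number of earlier picks) / (n + 1)\<close>, where
  \<open>\<gamma> = 1 / (2 + \<delta> / m) < 1 / 2\<close>. Products of rising factorials of these weights bound the probability
  that a self-avoiding path is present by the product of \<open>M max(u, v)^(\<gamma> - 1) min(u, v)^(-\<gamma>)\<close> over
  its edges. As \<open>\<gamma> < 1 / 2\<close>, this kernel is bounded with respect to the weight \<open>u^(-1/2)\<close>, so the
  expected number of pairs \<open>u \<le> v\<close> joined by a path of length at most \<open>k\<close> is at most \<open>C^(k + 1) t\<close>,
  which is \<open>O(t^(5/4))\<close> for \<open>k = c log t\<close> with small \<open>c\<close>.
  The graph need not be connected in model (a), but every component contains vertex 1, vertex 2 or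
  a vertex with a self-loop, and the expected number of self-loops is \<open>O(log t)\<close>. So with high
  probability some component has at least \<open>t^(7/8)\<close> vertices. If the diameter were at most \<open>k\<close>,
  this component alone would contain \<open>t^(7/4) / 2\<close> pairs at distance at most \<open>k\<close>.
\<close>

section \<open>The weighted path sum\<close>

text \<open>When v arrives, an older vertex u has degree of order (v/u)^\<gamma>, so v attaches to
  it with probability of order v^(\<gamma> - 1) u^(-\<gamma>); this is the origin of the edge
  kernel. At \<gamma> = 1/2 it degenerates to 1/sqrt(u v), whose path sums gain a factor log t per
  step, so the condition \<delta> > 0 is decisive here. The obstacle is dependence: draws of the
  same target reinforce each other, so the probabilities of the edges of a path cannot simply be
  multiplied. But a self-avoiding path asks for each target at most twice, so rising factorials of
  order at most two suffice and the reinforcement costs only a constant factor per edge. Only upper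
  bounds on attachment probabilities are used for this. Initial edges, edges sent out by the vertex
  itself and \<delta> can therefore all be absorbed into the constant W, and time can be measured by
  the number of draws. This lets one argument serve all three models, merged or not.\<close>

lemma sum_powr_le:
  fixes s :: real
  assumes s: "0 < s" "s < 1"
  shows "(\<Sum>u=1..n. real u powr (- s)) \<le> real n powr (1 - s) / (1 - s)"
proof (induction n)
  case (Suc n)
  have "real (Suc n) powr (- s) * (1 - s) \<le> real (Suc n) powr (1 - s) - real n powr (1 - s)"
  proof (cases "n = 0")
    case False
    then have "\<exists>z>real n. z < real (Suc n) \<and>
      real (Suc n) powr (1 - s) - real n powr (1 - s) = (real (Suc n) - real n) * ((1 - s) * z powr (1 - s - 1))"
      using False by (intro MVT2 has_real_derivative_powr) auto
    then obtain z where z: "z > real n" "z < real (Suc n)"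
      "real (Suc n) powr (1 - s) - real n powr (1 - s) = (1 - s) * z powr (- s)" by auto
    have "real (Suc n) powr (- s) \<le> z powr (- s)"
      using z(1,2) s by (intro powr_mono2') auto
    then show ?thesis using z(3) s by (simp add: mult.commute mult_left_mono)
  qed (use s in auto)
  then have "real (Suc n) powr (- s) \<le> real (Suc n) powr (1 - s) / (1 - s) - real n powr (1 - s) / (1 - s)"
    using s by (simp add: diff_divide_distrib[symmetric] pos_le_divide_eq)
  then show ?case using Suc by simp
qed auto

lemma sum_powr_tail_le:
  fixes s :: real
  assumes s: "s > 1" and v: "v \<ge> 1"
  shows "(\<Sum>u=Suc v..n. real u powr (- s)) \<le> real v powr (1 - s) / (s - 1)"
proof -
  have "(\<Sum>u=Suc v..n. real u powr (- s)) \<le> (real v powr (1 - s) - real n powr (1 - s)) / (s - 1)"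
    if "n \<ge> v" for n
    using that
  proof (induction n rule: dec_induct)
    case (step n)
    have "\<exists>z>real n. z < real (Suc n) \<and>
      real (Suc n) powr (1 - s) - real n powr (1 - s) = (real (Suc n) - real n) * ((1 - s) * z powr (1 - s - 1))"
      using step v by (intro MVT2 has_real_derivative_powr) auto
    then obtain z where z: "z > real n" "z < real (Suc n)"
      "real (Suc n) powr (1 - s) - real n powr (1 - s) = (1 - s) * z powr (- s)" by auto
    have "real (Suc n) powr (- s) \<le> z powr (- s)"
      using z(1,2) s by (intro powr_mono2') auto
    then have "(s - 1) * real (Suc n) powr (- s) \<le> (s - 1) * z powr (- s)"
      using s by (intro mult_left_mono) auto
    also have "\<dots> = real n powr (1 - s) - real (Suc n) powr (1 - s)"
      using z(3) by (simp add: algebra_simps)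
    finally have "real (Suc n) powr (- s) \<le> (real n powr (1 - s) - real (Suc n) powr (1 - s)) / (s - 1)"
      using s by (simp add: field_simps)
    moreover have "(\<Sum>u=Suc v..Suc n. real u powr (- s)) = (\<Sum>u=Suc v..n. real u powr (- s)) + real (Suc n) powr (- s)"
      using step by simp
    ultimately show ?case using step.IH by (simp add: diff_divide_distrib)
  qed auto
  moreover have "(real v powr (1 - s) - real n powr (1 - s)) / (s - 1) \<le> real v powr (1 - s) / (s - 1)"
    using s by (intro divide_right_mono) auto
  ultimately show ?thesis
    using s by (cases "n \<ge> v") (force, simp)
qed

definition edge_bound :: "real \<Rightarrow> nat \<Rightarrow> nat \<Rightarrow> real" where
  "edge_bound \<gamma> u v = real (max u v) powr (\<gamma> - 1) * real (min u v) powr (- \<gamma>)"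

lemma edge_bound_nonneg: "edge_bound \<gamma> u v \<ge> 0"
  by (simp add: edge_bound_def)

text \<open>A Schur test. With the weight u^(-s), the part u \<le> v is of order v^(-s) if s < 1 -
  \<gamma>, and the part u > v if s > \<gamma>. Such an s exists exactly when \<gamma> < 1/2; the
  midpoint s = 1/2 gives both parts the same constant 1/(1/2 - \<gamma>).\<close>

lemma sum_edge_bound_le:
  assumes \<gamma>: "0 < \<gamma>" "\<gamma> < 1/2" and v: "1 \<le> v" "v \<le> t"
  shows "(\<Sum>u=1..t. real u powr (- 1/2) * edge_bound \<gamma> u v) \<le> 2 / (1/2 - \<gamma>) * real v powr (- 1/2)"
proof -
  have "(\<Sum>u=1..t. real u powr (- 1/2) * edge_bound \<gamma> u v)
     = (\<Sum>u=1..v. real u powr (- 1/2) * edge_bound \<gamma> u v) + (\<Sum>u=Suc v..t. real u powr (- 1/2) * edge_bound \<gamma> u v)"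
    using v by (subst sum.union_disjoint[symmetric]) (auto intro!: sum.cong)
  also have "(\<Sum>u=1..v. real u powr (- 1/2) * edge_bound \<gamma> u v)
      = real v powr (\<gamma> - 1) * (\<Sum>u=1..v. real u powr (- (\<gamma> + 1/2)))"
    unfolding sum_distrib_left
    by (intro sum.cong) (auto simp: edge_bound_def max_def min_def powr_add[symmetric] algebra_simps)
  also have "\<dots> \<le> real v powr (\<gamma> - 1) * (real v powr (1 - (\<gamma> + 1/2)) / (1 - (\<gamma> + 1/2)))"
    using \<gamma> by (intro mult_left_mono sum_powr_le) auto
  also have "\<dots> = 1 / (1/2 - \<gamma>) * real v powr (- 1/2)"
    by (simp add: powr_add[symmetric])
  also have "(\<Sum>u=Suc v..t. real u powr (- 1/2) * edge_bound \<gamma> u v)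
      = real v powr (- \<gamma>) * (\<Sum>u=Suc v..t. real u powr (- (3/2 - \<gamma>)))"
    unfolding sum_distrib_left
    by (intro sum.cong) (auto simp: edge_bound_def max_def min_def powr_add[symmetric])
  also have "\<dots> \<le> real v powr (- \<gamma>) * (real v powr (1 - (3/2 - \<gamma>)) / ((3/2 - \<gamma>) - 1))"
    using \<gamma> v by (intro mult_left_mono sum_powr_tail_le) auto
  also have "\<dots> = 1 / (1/2 - \<gamma>) * real v powr (- 1/2)"
    by (simp add: powr_add[symmetric])
  finally show ?thesis by (simp add: algebra_simps)
qed

text \<open>Summing out the first vertex of the path is one application of the kernel to the weight,
  so the Schur constant is paid once per edge. The factor at \<open>last p\<close> cancels the
  weight that remains at the final vertex, which leaves a count of \<open>t\<close>.\<close>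

lemma sum_path_weight_le:
  assumes \<gamma>: "0 < \<gamma>" "\<gamma> < 1/2" and M: "M \<ge> 0"
  shows "(\<Sum>p | set p \<subseteq> {1..t} \<and> length p = Suc k.
       real (hd p) powr (- 1/2) * real (last p) powr (1/2) * (\<Prod>i<k. M * edge_bound \<gamma> (p ! i) (p ! Suc i)))
     \<le> (M * (2 / (1/2 - \<gamma>))) ^ k * real t"
proof (induction k)
  case 0
  have *: "{p. set p \<subseteq> {1..t} \<and> length p = Suc 0} = (\<lambda>u. [u]) ` {1..t}"
    by (auto simp: length_Suc_conv)
  have "(\<Sum>p | set p \<subseteq> {1..t} \<and> length p = Suc 0.
       real (hd p) powr (- 1/2) * real (last p) powr (1/2) * (\<Prod>i<0. M * edge_bound \<gamma> (p ! i) (p ! Suc i)))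
     = (\<Sum>u=1..t. real u powr (- 1/2) * real u powr (1/2))"
    unfolding * by (subst sum.reindex) (auto simp: inj_on_def)
  also have "\<dots> = (\<Sum>u=1..t. 1)"
    by (intro sum.cong) (auto simp: powr_add[symmetric])
  finally show ?case by simp
next
  case (Suc k)
  let ?L = "{p. set p \<subseteq> {1..t} \<and> length p = Suc k}"
  let ?w = "\<lambda>p. \<Prod>i<k. M * edge_bound \<gamma> (p ! i) (p ! Suc i)"
  have eq: "(\<Sum>p | set p \<subseteq> {1..t} \<and> length p = Suc (Suc k).
       real (hd p) powr (- 1/2) * real (last p) powr (1/2) * (\<Prod>i<Suc k. M * edge_bound \<gamma> (p ! i) (p ! Suc i)))
    = (\<Sum>(p,u)\<in>?L \<times> {1..t}. real u powr (- 1/2) * real (last p) powr (1/2) *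
          (M * edge_bound \<gamma> u (hd p) * ?w p))"
    unfolding lists_length_Suc_eq[of "{1..t}" "Suc k"]
    by (subst sum.reindex)
       (auto simp: inj_on_def prod.lessThan_Suc_shift hd_conv_nth simp del: prod.lessThan_Suc
          intro!: sum.cong split: prod.splits)
  also have "\<dots> = (\<Sum>p\<in>?L. \<Sum>u=1..t. real u powr (- 1/2) * real (last p) powr (1/2) *
          (M * edge_bound \<gamma> u (hd p) * ?w p))"
    by (rule sum.cartesian_product[symmetric])
  also have "\<dots> = (\<Sum>p\<in>?L. real (last p) powr (1/2) * M * ?w p *
       (\<Sum>u=1..t. real u powr (- 1/2) * edge_bound \<gamma> u (hd p)))"
    unfolding sum_distrib_left by (intro sum.cong refl) (simp add: mult_ac)
  also have "\<dots> \<le> (\<Sum>p\<in>?L. real (last p) powr (1/2) * M * ?w p *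
       (2 / (1/2 - \<gamma>) * real (hd p) powr (- 1/2)))"
  proof (intro sum_mono mult_left_mono sum_edge_bound_le \<gamma>)
    fix p assume "p \<in> ?L"
    then have "hd p \<in> {1..t}" by (cases p) auto
    then show "1 \<le> hd p" "hd p \<le> t" by auto
    show "0 \<le> real (last p) powr (1/2) * M * ?w p"
      using M by (intro mult_nonneg_nonneg prod_nonneg) (auto intro: edge_bound_nonneg)
  qed
  also have "\<dots> = (M * (2 / (1/2 - \<gamma>))) * (\<Sum>p\<in>?L. real (hd p) powr (- 1/2) * real (last p) powr (1/2) * ?w p)"
    unfolding sum_distrib_left by (intro sum.cong refl) (simp add: mult_ac)
  also have "\<dots> \<le> (M * (2 / (1/2 - \<gamma>))) * ((M * (2 / (1/2 - \<gamma>))) ^ k * real t)"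
    using Suc M \<gamma> by (intro mult_left_mono) auto
  finally show ?case by (simp add: mult_ac)
qed

text \<open>The factor by which a pending edge towards \<open>a\<close> grows up to time \<open>n\<close>.\<close>
lemma prod_growth_le:
  fixes \<gamma> :: real
  assumes \<gamma>: "0 < \<gamma>" "\<gamma> < 1" and a: "1 \<le> a" "a \<le> 3 * (n + 1)"
  shows "(\<Prod>j<n. if a \<le> 3 * (j + 1) then 1 + \<gamma> / real (j + 1) else 1) \<le> 2 * (3 * real (n + 1) / real a) powr \<gamma>"
proof -
  have *: "(\<Prod>j<n. if a \<le> 3 * (j + 1) then 1 + \<gamma> / real (j + 1) else 1)
     \<le> (if a \<le> 3 * n then 2 * (3 * real n / real a) powr \<gamma> else 1)" (is "?P n \<le> _") for n
  proof (induction n)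
    case (Suc n)
    \<comment> \<open>The second case is the first index with a nontrivial factor: that factor is at
      most 2, the constant of the bound. Every later factor is at most ((n + 1)/n)^\<gamma>, and
      these telescope.\<close>
    consider "a \<le> 3 * n" | "a \<le> 3 * Suc n" "\<not> a \<le> 3 * n" | "\<not> a \<le> 3 * Suc n" by linarith
    then show ?case
    proof cases
      case 1
      then have n: "n \<ge> 1" using a by (cases n) auto
      have "1 + \<gamma> / real (n + 1) \<le> exp (\<gamma> / real (n + 1))" by (rule exp_ge_add_one_self)
      also have "\<dots> \<le> exp (\<gamma> * ln ((real n + 1) / real n))"
      proof -
        have "ln (real n / (real n + 1)) \<le> real n / (real n + 1) - 1"
          using n by (intro ln_le_minus_one) auto
        also have "\<dots> = - (1 / (real n + 1))" by (simp add: field_simps)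
        finally have "1 / (real n + 1) \<le> ln ((real n + 1) / real n)"
          using n by (simp add: ln_div)
        then have "\<gamma> * (1 / (real n + 1)) \<le> \<gamma> * ln ((real n + 1) / real n)"
          using \<gamma> by (intro mult_left_mono) auto
        then show ?thesis by (simp add: add.commute)
      qed
      also have "\<dots> = ((real n + 1) / real n) powr \<gamma>"
        using n by (simp add: powr_def)
      finally have g: "1 + \<gamma> / real (n + 1) \<le> ((real n + 1) / real n) powr \<gamma>" .
      have "?P (Suc n) = ?P n * (1 + \<gamma> / real (n + 1))" using 1 by simp
      also have "\<dots> \<le> (2 * (3 * real n / real a) powr \<gamma>) * ((real n + 1) / real n) powr \<gamma>"
        using Suc g 1 \<gamma> by (intro mult_mono) auto
      also have "\<dots> = 2 * ((3 * real n / real a) * ((real n + 1) / real n)) powr \<gamma>"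
        by (subst powr_mult) auto
      also have "(3 * real n / real a) * ((real n + 1) / real n) = 3 * real (Suc n) / real a"
        using n a by (subst times_divide_times_eq) (simp add: frac_eq_eq algebra_simps)
      finally show ?thesis using 1 by simp
    next
      case 2
      have "?P (Suc n) = ?P n * (1 + \<gamma> / real (n + 1))" using 2 by simp
      also have "\<dots> \<le> 1 * 2"
        using Suc 2 \<gamma> by (intro mult_mono) (auto simp: field_simps)
      also have "1 \<le> (3 * real (Suc n) / real a) powr \<gamma>"
        using 2 a \<gamma> by (intro ge_one_powr_ge_zero) (auto simp: field_simps)
      finally show ?thesis using 2 by simp
    next
      case 3
      then show ?thesis using Suc by simp
    qed
  qed (use a in auto)
  have "1 \<le> (3 * real (n + 1) / real a) powr \<gamma>"
    using a \<gamma> by (intro ge_one_powr_ge_zero) (auto simp: field_simps)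
  moreover have "(3 * real n / real a) powr \<gamma> \<le> (3 * real (n + 1) / real a) powr \<gamma>"
    using a \<gamma> by (intro powr_mono2) (auto intro!: divide_right_mono)
  ultimately show ?thesis using *[of n] by (auto split: if_splits)
qed

section \<open>Walks and the diameter\<close>

definition connected_by :: "'a multigraph \<Rightarrow> 'a list \<Rightarrow> 'a \<Rightarrow> 'a \<Rightarrow> bool" where
  "connected_by G p u v \<longleftrightarrow> walk G p \<and> hd p = u \<and> last p = v"

lemma connected_by_rev: "connected_by G p u v \<Longrightarrow> connected_by G (rev p) v u"
proof -
  assume p: "connected_by G p u v"
  have "successively (\<lambda>x y. Upair y x \<in># edges G) p = successively (\<lambda>x y. Upair x y \<in># edges G) p"
    by (intro arg_cong[where f = "\<lambda>P. successively P p"] ext arg_cong[where f = "\<lambda>e. e \<in># edges G"]) auto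
  then show ?thesis
    using p by (simp add: connected_by_def walk_def hd_rev last_rev successively_rev)
qed

lemma connected_by_append:
  assumes "connected_by G p u v" "connected_by G q v w"
  shows "connected_by G (p @ tl q) u w"
proof (cases q)
  case (Cons x q')
  then show ?thesis using assms
    by (cases q') (auto simp: connected_by_def walk_def successively_append_iff successively_Cons)
qed (use assms in \<open>auto simp: connected_by_def walk_def\<close>)

lemma connected_by_distinct:
  assumes "connected_by G p u v"
  shows "\<exists>q. connected_by G q u v \<and> distinct q \<and> length q \<le> length p"
  using assms
proof (induction "length p" arbitrary: p rule: less_induct)
  case less
  show ?case
  proof (cases "distinct p")
    case False
    then obtain as bs cs y where p: "p = as @ [y] @ bs @ [y] @ cs"
      using not_distinct_decomp by blast
    have "connected_by G (as @ [y] @ cs) u v"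
      unfolding connected_by_def walk_def
    proof (intro conjI)
      have w: "set p \<subseteq> verts G" "successively (\<lambda>u v. Upair u v \<in># edges G) p"
        and hl: "hd p = u" "last p = v"
        using less(2) by (auto simp: connected_by_def walk_def)
      show "as @ [y] @ cs \<noteq> []" by simp
      show "set (as @ [y] @ cs) \<subseteq> verts G" using w(1) by (auto simp: p)
      show "successively (\<lambda>u v. Upair u v \<in># edges G) (as @ [y] @ cs)"
        using w(2) unfolding p successively_append_iff by auto
      show "hd (as @ [y] @ cs) = u" using hl(1) unfolding p by (cases as) auto
      show "last (as @ [y] @ cs) = v" using hl(2) unfolding p by (cases "cs = []") auto
    qed
    moreover have "length (as @ [y] @ cs) < length p" by (simp add: p)
    ultimately show ?thesis using less(1)[of "as @ [y] @ cs"] by (meson le_trans less_imp_le)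
  qed (use less in auto)
qed

text \<open>The infimum in \<open>gdist\<close> is attained because \<open>enat\<close> is
  well-ordered. Distinctness is required since the probability estimates hold for self-avoiding
  vertex lists only. The bound counts vertices, hence the \<open>Suc\<close>.\<close>

lemma connected_by_diam:
  assumes fin: "finite (verts G)" and p: "connected_by G p u v"
  shows "\<exists>q. connected_by G q u v \<and> distinct q \<and> length q \<le> Suc (diam G)"
proof -
  let ?A = "(\<lambda>p. enat (length p - 1)) ` {p. walk G p \<and> hd p = u \<and> last p = v}"
  have "enat (length p - 1) \<in> ?A" using p by (intro imageI) (simp add: connected_by_def)
  then have "Inf ?A \<in> ?A" by (rule wellorder_InfI)
  then obtain q where q: "walk G q" "hd q = u" "last q = v" "gdist G u v = enat (length q - 1)"
    unfolding gdist_def by auto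
  have uv: "u \<in> verts G" "v \<in> verts G"
    using p hd_in_set[of p] last_in_set[of p] by (auto simp: connected_by_def walk_def)
  let ?D = "{the_enat (gdist G i j) | i j. i \<in> verts G \<and> j \<in> verts G \<and> gdist G i j < \<infinity>}"
  have "?D \<subseteq> (\<lambda>(i, j). the_enat (gdist G i j)) ` (verts G \<times> verts G)" by auto
  then have "finite ?D" using fin by (meson finite_SigmaI finite_imageI finite_subset)
  moreover have "length q - 1 \<in> ?D"
    unfolding mem_Collect_eq using uv q(4) by (intro exI[of _ u] exI[of _ v]) simp
  ultimately have "length q - 1 \<le> diam G" unfolding diam_def by (rule Max_ge)
  then show ?thesis
    using connected_by_distinct[of G q u v] q(1-3) by (fastforce simp: connected_by_def)
qed

text \<open>All that the lower bound needs to know of the graph; multiplicities are dropped. Edges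
  of the initial graph are only located among the vertices up to 2, which holds in every model and
  survives merging.\<close>

definition realizes :: "('a \<Rightarrow> nat) \<Rightarrow> (nat \<Rightarrow> nat) \<Rightarrow> nat \<Rightarrow> nat \<Rightarrow> 'a list \<Rightarrow> nat multigraph \<Rightarrow> bool" where
  "realizes tgt src t N xs G \<longleftrightarrow> verts G = {1..t} \<and>
     (\<forall>u v. Upair u v \<in># edges G \<longrightarrow> u \<le> 2 \<and> v \<le> 2 \<or> (\<exists>n<N. Upair u v = Upair (src n) (tgt (xs ! n)))) \<and>
     (\<forall>n<N. Upair (src n) (tgt (xs ! n)) \<in># edges G)"

section \<open>Attachment by successive draws\<close>

primrec draws :: "('a list \<Rightarrow> 'a pmf) \<Rightarrow> nat \<Rightarrow> 'a list pmf" where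
  "draws K 0 = return_pmf []"
| "draws K (Suc n) = do {xs \<leftarrow> draws K n; i \<leftarrow> K xs; return_pmf (xs @ [i])}"

lemma length_draws: "xs \<in> set_pmf (draws K n) \<Longrightarrow> length xs = n"
  by (induction n arbitrary: xs) auto

lemma draws_nth:
  assumes "xs \<in> set_pmf (draws K n)" "j < n"
  shows "take j xs \<in> set_pmf (draws K j) \<and> xs ! j \<in> set_pmf (K (take j xs))"
  using assms
proof (induction n arbitrary: xs)
  case (Suc n)
  then obtain ys i where ys: "ys \<in> set_pmf (draws K n)" "i \<in> set_pmf (K ys)" "xs = ys @ [i]"
    by auto
  have "length ys = n" using ys(1) by (rule length_draws)
  then show ?case using Suc.IH[of ys] Suc.prems ys by (cases "j = n") (auto simp: nth_append)
qed auto

lemma pochhammer_shift: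
  fixes y :: real
  assumes "y > 0"
  shows "pochhammer (y + 1) r = pochhammer y r * (1 + real r / y)"
proof -
  have "y * pochhammer (y + 1) r = pochhammer y r * (y + real r)"
    using pochhammer_rec[of y r] pochhammer_Suc[of y r] by simp
  then show ?thesis using assms by (simp add: field_simps)
qed

text \<open>A draw is an unmerged vertex, \<open>tgt\<close> its block, and \<open>src n\<close> the
  block that sends out the edge of draw \<open>n\<close>. Each block sends out \<open>m\<close>
  edges, so \<open>m * src n\<close> equals \<open>n\<close> up to the initial vertices and
  rounding, which the slack \<open>3 * m\<close> covers. The attachment rule enters through the
  upper bound \<open>kernel_le\<close> alone.\<close>

locale attachment =
  fixes K :: "'a list \<Rightarrow> 'a pmf" and tgt :: "'a \<Rightarrow> nat" and src :: "nat \<Rightarrow> nat"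
    and m :: nat and \<gamma> W :: real
  assumes \<gamma>: "0 < \<gamma>" "\<gamma> < 1/2" and W: "W > 0" and m: "m \<ge> 1"
    and src_gt: "n < m * src n" and src_le: "m * src n \<le> n + 3 * m"
    and tgt_bounds: "xs \<in> set_pmf (draws K n) \<Longrightarrow> i \<in> set_pmf (K xs) \<Longrightarrow> 1 \<le> tgt i \<and> tgt i \<le> src n"
    and kernel_le: "xs \<in> set_pmf (draws K n) \<Longrightarrow>
      measure_pmf.prob (K xs) {i. tgt i = a} \<le> \<gamma> * (W + real (count_list (map tgt xs) a)) / real (n + 1)"
begin

lemma src_le': "src n \<le> 3 * (n + 1)"
proof -
  have "m * src n \<le> m * (n + 3)" using src_le[of n] m by (simp add: algebra_simps) (metis le_trans mult_le_mono1 nat_mult_1 add_le_cancel_right m)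
  then show ?thesis using m by simp
qed

lemma src_pos: "src n \<ge> 1"
  using src_gt[of n] by (cases "src n") auto

lemma tgt_nth_bounds:
  assumes "xs \<in> set_pmf (draws K N)" "n < N"
  shows "1 \<le> tgt (xs ! n)" "tgt (xs ! n) \<le> src n"
  using draws_nth[OF assms] tgt_bounds by blast+

section \<open>A supermartingale for prescribed targets\<close>

definition pending :: "nat set \<Rightarrow> (nat \<Rightarrow> nat) \<Rightarrow> nat \<Rightarrow> nat \<Rightarrow> nat" where
  "pending S f n a = card {j \<in> S. n \<le> j \<and> f j = a}"

text \<open>\<open>f\<close> prescribes the targets of the draws in \<open>S\<close>. Up to
  deterministic factors this bounds the conditional probability, given the draws so far, that all
  prescriptions are met: it vanishes once one is missed, and a weight from which \<open>r\<close>
  hits are still due enters through its rising factorial of order \<open>r\<close>.\<close>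

definition potential :: "nat set \<Rightarrow> (nat \<Rightarrow> nat) \<Rightarrow> nat \<Rightarrow> 'a list \<Rightarrow> real" where
  "potential S f n xs = (if \<forall>j\<in>S. j < n \<longrightarrow> tgt (xs ! j) = f j
     then \<Prod>a\<in>f ` S. pochhammer (W + real (count_list (map tgt xs) a)) (pending S f n a) else 0)"

text \<open>A prescribed draw costs its probability without the weight; any other draw inflates the
  potential by its expected relative gain. Targets beyond \<open>src n\<close> cannot be drawn yet
  and must not be counted: this is what yields a power of \<open>j / f j\<close> instead of
  \<open>j\<close> later.\<close>

definition growth :: "nat set \<Rightarrow> (nat \<Rightarrow> nat) \<Rightarrow> nat \<Rightarrow> real" where
  "growth S f n = (if n \<in> S then \<gamma> / real (n + 1)
     else 1 + real (card {j \<in> S. n \<le> j \<and> f j \<le> src n}) * (\<gamma> / real (n + 1)))"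

lemma weight_pos: "W + real c > 0"
  using W by linarith

lemma potential_nonneg: "potential S f n xs \<ge> 0"
  unfolding potential_def by (auto intro!: prod_nonneg pochhammer_nonneg weight_pos)

text \<open>Each draw adds 1 to the weight of the drawn target, so the rising factorial of order
  \<open>r\<close> of a weight \<open>y\<close> grows by the factor \<open>1 + r/y\<close> with probability proportional to \<open>y\<close>.
  Hence the product of the rising factorials over all targets, divided by the deterministic
  factors \<^const>\<open>growth\<close>, is a supermartingale; this replaces a correlation inequality.\<close>
lemma potential_step:
  assumes S: "finite S" and xs: "xs \<in> set_pmf (draws K n)"
  shows "(\<integral>\<^sup>+i. ennreal (potential S f (Suc n) (xs @ [i])) \<partial>measure_pmf (K xs))
           \<le> ennreal (growth S f n) * ennreal (potential S f n xs)"
proof -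
  have len: "length xs = n" using xs by (rule length_draws)
  let ?y = "\<lambda>a. W + real (count_list (map tgt xs) a)"
  let ?p = "\<lambda>a. measure_pmf.prob (K xs) {i. tgt i = a}"
  have y: "?y a > 0" for a by (rule weight_pos)
  have p: "?p a \<le> \<gamma> * ?y a / real (n + 1)" for a using kernel_le[OF xs] .
  have p0: "?p a = 0" if "a > src n" for a
  proof -
    have "set_pmf (K xs) \<inter> {i. tgt i = a} = {}" using tgt_bounds[OF xs] that by fastforce
    then show ?thesis by (simp add: measure_pmf_zero_iff)
  qed
  have past: "(\<forall>j\<in>S. j < Suc n \<longrightarrow> tgt ((xs @ [i]) ! j) = f j) \<longleftrightarrow>
      (\<forall>j\<in>S. j < n \<longrightarrow> tgt (xs ! j) = f j) \<and> (n \<in> S \<longrightarrow> tgt i = f n)" for i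
    using len by (auto simp: nth_append less_Suc_eq)
  show ?thesis
  proof (cases "\<forall>j\<in>S. j < n \<longrightarrow> tgt (xs ! j) = f j")
    case False
    then have "potential S f (Suc n) (xs @ [i]) = 0" for i
      unfolding potential_def past by auto
    then show ?thesis by simp
  next
    case past_ok: True
    have pot: "potential S f n xs = (\<Prod>a\<in>f ` S. pochhammer (?y a) (pending S f n a))"
      using past_ok by (simp add: potential_def)
    show ?thesis
    proof (cases "n \<in> S")
      case True
      let ?r = "pending S f n"
      have r: "pending S f (Suc n) a = (if a = f n then ?r a - 1 else ?r a)"
        and rpos: "?r (f n) \<ge> 1" for a
      proof -
        have fin: "finite {j \<in> S. n \<le> j \<and> f j = a}" for a using S by auto
        have "{j \<in> S. Suc n \<le> j \<and> f j = a} = (if a = f n then {j \<in> S. n \<le> j \<and> f j = a} - {n} else {j \<in> S. n \<le> j \<and> f j = a})"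
          by (auto simp: Suc_le_eq order_less_le)
        then show "pending S f (Suc n) a = (if a = f n then ?r a - 1 else ?r a)"
          using True fin by (auto simp: pending_def)
        show "?r (f n) \<ge> 1"
          using True fin[of "f n"] by (auto simp: pending_def Suc_le_eq card_gt_0_iff)
      qed
      define C where "C = (\<Prod>a\<in>f ` S - {f n}. pochhammer (?y a) (?r a))"
      have C: "C \<ge> 0" unfolding C_def by (intro prod_nonneg) (auto intro!: pochhammer_nonneg y)
      \<comment> \<open>The first factor of the rising factorial cancels against the weight in the
        drawing probability. The remaining ones form the rising factorial for the weight raised by
        1, which is the new potential of this target.\<close>
      define D where "D = pochhammer (?y (f n) + 1) (?r (f n) - 1)"
      have "?y (f n) + 1 > 0" using y[of "f n"] by linarith
      then have D: "D \<ge> 0" unfolding D_def by (intro pochhammer_nonneg)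
      have fn: "f n \<in> f ` S" "finite (f ` S)" using True S by auto
      have "potential S f n xs = pochhammer (?y (f n)) (?r (f n)) * C"
        unfolding pot C_def using fn by (subst prod.remove[of _ "f n"]) auto
      also have "pochhammer (?y (f n)) (?r (f n)) = ?y (f n) * D"
        unfolding D_def using rpos pochhammer_rec[of "?y (f n)" "?r (f n) - 1"] by simp
      finally have pot2: "potential S f n xs = ?y (f n) * D * C" .
      have "potential S f (Suc n) (xs @ [i]) = D * C * indicator {i. tgt i = f n} i" for i
      proof (cases "tgt i = f n")
        case ti: True
        have "potential S f (Suc n) (xs @ [i]) =
           (\<Prod>a\<in>f ` S. pochhammer (W + real (count_list (map tgt (xs @ [i])) a)) (pending S f (Suc n) a))"
          unfolding potential_def past using past_ok ti by simp
        also have "\<dots> = D * C"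
          unfolding C_def D_def using fn
          by (subst prod.remove[of _ "f n"]) (auto simp: ti r add_ac intro!: prod.cong arg_cong2[where f = "(*)"])
        finally show ?thesis using ti by simp
      next
        case False
        then show ?thesis unfolding potential_def past using True by auto
      qed
      then have "(\<integral>\<^sup>+i. ennreal (potential S f (Suc n) (xs @ [i])) \<partial>measure_pmf (K xs))
         = (\<integral>\<^sup>+i. ennreal (D * C) * indicator {i. tgt i = f n} i \<partial>measure_pmf (K xs))"
        using C D by (intro nn_integral_cong) (auto split: split_indicator)
      also have "\<dots> = ennreal (D * C) * ennreal (?p (f n))"
        by (subst nn_integral_cmult_indicator) (auto simp: measure_pmf.emeasure_eq_measure)
      also have "\<dots> \<le> ennreal (D * C) * ennreal (\<gamma> * ?y (f n) / real (n + 1))"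
        by (intro mult_left_mono ennreal_leI p) auto
      also have "\<dots> = ennreal (growth S f n) * ennreal (potential S f n xs)"
        using C D y[of "f n"] \<gamma> True unfolding pot2 growth_def
        by (simp add: ennreal_mult[symmetric] mult_ac)
      finally show ?thesis .
    next
      case False
      let ?r = "pending S f n"
      let ?\<Psi> = "potential S f n xs"
      have r: "pending S f (Suc n) a = ?r a" for a
        unfolding pending_def using False by (intro arg_cong[where f = card]) (auto simp: Suc_le_eq order_less_le)
      have fin: "finite (f ` S)" using S by auto
      \<comment> \<open>A draw hits at most one target, so the product of the factors 1 + r/y
        collapses to one plus a sum, which is linear in the indicators and can be integrated
        termwise.\<close>
      have pot': "potential S f (Suc n) (xs @ [i])
          = ?\<Psi> * (1 + (\<Sum>a\<in>f ` S. real (?r a) / ?y a * indicator {i. tgt i = a} i))" for i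
      proof -
        have "potential S f (Suc n) (xs @ [i]) =
           (\<Prod>a\<in>f ` S. pochhammer (W + real (count_list (map tgt (xs @ [i])) a)) (?r a))"
          unfolding potential_def past using past_ok False r by simp
        also have "\<dots> = (\<Prod>a\<in>f ` S. pochhammer (?y a) (?r a) * (if a = tgt i then 1 + real (?r a) / ?y a else 1))"
        proof (intro prod.cong refl)
          fix a
          show "pochhammer (W + real (count_list (map tgt (xs @ [i])) a)) (?r a)
              = pochhammer (?y a) (?r a) * (if a = tgt i then 1 + real (?r a) / ?y a else 1)"
            using pochhammer_shift[OF y[of a], of "?r a"] by (auto simp: add.assoc)
        qed
        also have "\<dots> = ?\<Psi> * (if tgt i \<in> f ` S then 1 + real (?r (tgt i)) / ?y (tgt i) else 1)"
          unfolding prod.distrib pot using fin by (subst prod.delta) auto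
        also have "(if tgt i \<in> f ` S then 1 + real (?r (tgt i)) / ?y (tgt i) else 1)
            = 1 + (\<Sum>a\<in>f ` S. if a = tgt i then real (?r a) / ?y a else 0)"
          using fin by (subst sum.delta) auto
        also have "(\<Sum>a\<in>f ` S. if a = tgt i then real (?r a) / ?y a else 0) =
            (\<Sum>a\<in>f ` S. real (?r a) / ?y a * indicator {i. tgt i = a} i)"
          by (intro sum.cong) auto
        finally show ?thesis .
      qed
      have int: "integrable (measure_pmf (K xs)) (\<lambda>i. indicator {i. tgt i = a} i :: real)" for a
        by (intro measure_pmf.integrable_const_bound[where B = 1]) auto
      have int': "integrable (measure_pmf (K xs)) (\<lambda>i. potential S f (Suc n) (xs @ [i]))"
        unfolding pot'
        by (intro integrable_mult_right Bochner_Integration.integrable_add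
            Bochner_Integration.integrable_sum int) auto
      have "(\<integral>\<^sup>+i. ennreal (potential S f (Suc n) (xs @ [i])) \<partial>measure_pmf (K xs))
        = ennreal (\<integral>i. potential S f (Suc n) (xs @ [i]) \<partial>measure_pmf (K xs))"
        by (intro nn_integral_eq_integral int' AE_I2 potential_nonneg)
      moreover have "(\<integral>i. potential S f (Suc n) (xs @ [i]) \<partial>measure_pmf (K xs))
          \<le> ?\<Psi> * growth S f n"
      proof -
        have "(\<integral>i. potential S f (Suc n) (xs @ [i]) \<partial>measure_pmf (K xs))
            = ?\<Psi> * (1 + (\<Sum>a\<in>f ` S. real (?r a) / ?y a * ?p a))"
          unfolding pot' using int by (simp add: Bochner_Integration.integral_add Bochner_Integration.integral_sum)
        also have "\<dots> \<le> ?\<Psi> * growth S f n"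
        proof (intro mult_left_mono potential_nonneg)
          have "(\<Sum>a\<in>f ` S. real (?r a) / ?y a * ?p a)
              \<le> (\<Sum>a\<in>f ` S. real (card {j \<in> {j\<in>S. n \<le> j \<and> f j \<le> src n}. f j = a}) * (\<gamma> / real (n + 1)))"
          proof (intro sum_mono)
            fix a
            show "real (?r a) / ?y a * ?p a \<le> real (card {j \<in> {j\<in>S. n \<le> j \<and> f j \<le> src n}. f j = a}) * (\<gamma> / real (n + 1))"
            proof (cases "a \<le> src n")
              case True
              have "{j \<in> {j\<in>S. n \<le> j \<and> f j \<le> src n}. f j = a} = {j\<in>S. n \<le> j \<and> f j = a}"
                using True by auto
              moreover have "real (?r a) / ?y a * ?p a \<le> real (?r a) / ?y a * (\<gamma> * ?y a / real (n + 1))"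
                using y[of a] by (intro mult_left_mono p) auto
              ultimately show ?thesis using y[of a] by (simp add: pending_def)
            next
              case False
              then show ?thesis using p0[of a] \<gamma> by simp
            qed
          qed
          also have "\<dots> = real (card {j\<in>S. n \<le> j \<and> f j \<le> src n}) * (\<gamma> / real (n + 1))"
          proof -
            define T where "T = {j\<in>S. n \<le> j \<and> f j \<le> src n}"
            have "finite T" "f ` T \<subseteq> f ` S" using S by (auto simp: T_def)
            then have "(\<Sum>a\<in>f ` S. real (card {j \<in> T. f j = a})) = real (card T)"
              using sum.group[of T "f ` S" f "\<lambda>_. 1::real"] fin by simp
            then show ?thesis by (simp only: T_def[symmetric] sum_distrib_right[symmetric])
          qed
          finally show "1 + (\<Sum>a\<in>f ` S. real (?r a) / ?y a * ?p a) \<le> growth S f n"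
            using False by (simp add: growth_def)
        qed
        finally show ?thesis .
      qed
      ultimately show ?thesis
        using \<gamma> by (simp add: ennreal_mult[symmetric] growth_def potential_nonneg mult.commute ennreal_leI)
    qed
  qed
qed

lemma potential_draws:
  assumes S: "finite S"
  shows "(\<integral>\<^sup>+xs. ennreal (potential S f n xs) \<partial>measure_pmf (draws K n))
    \<le> ennreal ((\<Prod>j<n. growth S f j) * potential S f 0 [])"
proof (induction n)
  case (Suc n)
  have gr: "growth S f j \<ge> 0" for j using \<gamma> by (simp add: growth_def)
  have "(\<integral>\<^sup>+xs. ennreal (potential S f (Suc n) xs) \<partial>measure_pmf (draws K (Suc n)))
      = (\<integral>\<^sup>+xs. (\<integral>\<^sup>+i. ennreal (potential S f (Suc n) (xs @ [i])) \<partial>measure_pmf (K xs)) \<partial>measure_pmf (draws K n))"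
    by simp
  also have "\<dots> \<le> (\<integral>\<^sup>+xs. ennreal (growth S f n) * ennreal (potential S f n xs) \<partial>measure_pmf (draws K n))"
    by (intro nn_integral_mono_AE AE_pmfI potential_step S)
  also have "\<dots> = ennreal (growth S f n) * (\<integral>\<^sup>+xs. ennreal (potential S f n xs) \<partial>measure_pmf (draws K n))"
    by (intro nn_integral_cmult) auto
  also have "\<dots> \<le> ennreal (growth S f n) * ennreal ((\<Prod>j<n. growth S f j) * potential S f 0 [])"
    by (intro mult_left_mono Suc) auto
  also have "\<dots> = ennreal ((\<Prod>j<Suc n. growth S f j) * potential S f 0 [])"
    using gr by (subst ennreal_mult[symmetric]) (auto intro!: mult_nonneg_nonneg prod_nonneg potential_nonneg simp: mult_ac)
  finally show ?case .
qed simp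

text \<open>At time \<open>N\<close> nothing is pending and every rising factorial has order 0, so
  the potential has become the indicator of the event.\<close>

lemma prob_targets_growth:
  assumes S: "finite S" "S \<subseteq> {..<N}"
  shows "measure_pmf.prob (draws K N) {xs. \<forall>j\<in>S. tgt (xs ! j) = f j}
    \<le> (\<Prod>j<N. growth S f j) * potential S f 0 []"
proof -
  have "pending S f N a = 0" for a
    using S by (auto simp: pending_def)
  then have pot: "potential S f N xs = indicator {xs. \<forall>j\<in>S. tgt (xs ! j) = f j} xs" for xs
    using S by (auto simp: potential_def split: split_indicator)
  have "ennreal (measure_pmf.prob (draws K N) {xs. \<forall>j\<in>S. tgt (xs ! j) = f j})
    = (\<integral>\<^sup>+xs. ennreal (potential S f N xs) \<partial>measure_pmf (draws K N))"
    unfolding pot ennreal_indicator by (simp add: measure_pmf.emeasure_eq_measure)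
  also have "\<dots> \<le> ennreal ((\<Prod>j<N. growth S f j) * potential S f 0 [])"
    by (rule potential_draws[OF S(1)])
  finally show ?thesis
    using \<gamma> by (subst (asm) ennreal_le_iff)
      (auto intro!: mult_nonneg_nonneg prod_nonneg potential_nonneg simp: growth_def)
qed

text \<open>Initially all weights are \<open>W\<close>, and W (W + 1) \<le> (W + 1)^2. The
  restriction to two hits per target excludes the factorial growth of higher orders and keeps the
  cost at one constant per draw.\<close>

lemma potential_0_le:
  assumes S: "finite S" and f: "\<And>a. card {j \<in> S. f j = a} \<le> 2"
  shows "potential S f 0 [] \<le> (W + 1) ^ card S"
proof -
  have "potential S f 0 [] = (\<Prod>a\<in>f ` S. pochhammer W (card {j \<in> S. f j = a}))"
    by (simp add: potential_def pending_def)
  also have "\<dots> \<le> (\<Prod>a\<in>f ` S. (W + 1) ^ card {j \<in> S. f j = a})"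
  proof (intro prod_mono conjI)
    fix a
    show "0 \<le> pochhammer W (card {j \<in> S. f j = a})" using W by (intro pochhammer_nonneg)
    consider "card {j \<in> S. f j = a} = 0" | "card {j \<in> S. f j = a} = 1" | "card {j \<in> S. f j = a} = 2"
      using f[of a] by linarith
    then show "pochhammer W (card {j \<in> S. f j = a}) \<le> (W + 1) ^ card {j \<in> S. f j = a}"
    proof cases
      case 3
      have "pochhammer W 2 = W * (W + 1)" by (simp add: numeral_2_eq_2 pochhammer_rec)
      also have "\<dots> \<le> (W + 1) ^ 2" using W by (simp add: power2_eq_square)
      finally show ?thesis unfolding 3 .
    qed (use W in auto)
  qed
  also have "\<dots> = (W + 1) ^ (\<Sum>a\<in>f ` S. card {j \<in> S. f j = a})"
    by (rule power_sum[symmetric])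
  also have "(\<Sum>a\<in>f ` S. card {j \<in> S. f j = a}) = card S"
    using sum.group[of S "f ` S" f "\<lambda>_. 1::nat"] S by simp
  finally show ?thesis .
qed

text \<open>Bernoulli's inequality 1 + k x \<le> (1 + x)^k gives every pending draw its own factor.
  The product over time then splits into one product for each prescribed draw, to which
  \<open>prod_growth_le\<close> applies.\<close>

lemma prod_growth_targets_le:
  assumes S: "finite S" "S \<subseteq> {..<N}" and f: "\<And>j. j \<in> S \<Longrightarrow> 1 \<le> f j \<and> f j \<le> src j"
  shows "(\<Prod>n<N. growth S f n) \<le> (\<Prod>j\<in>S. \<gamma> / real (j + 1) * (2 * (3 * real (j + 1) / real (f j)) powr \<gamma>))"
proof -
  have "(\<Prod>n<N. growth S f n) \<le> (\<Prod>n<N. (if n \<in> S then \<gamma> / real (n + 1) else 1) *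
       (\<Prod>j\<in>S. if n < j \<and> f j \<le> src n then 1 + \<gamma> / real (n + 1) else 1))"
  proof (intro prod_mono conjI)
    fix n
    show "0 \<le> growth S f n" using \<gamma> by (simp add: growth_def)
    have eq: "(\<Prod>j\<in>S. if n < j \<and> f j \<le> src n then 1 + \<gamma> / real (n + 1) else 1)
       = (1 + \<gamma> / real (n + 1)) ^ card {j\<in>S. n < j \<and> f j \<le> src n}"
      using S(1) by (subst prod.inter_filter[symmetric]) auto
    show "growth S f n \<le> (if n \<in> S then \<gamma> / real (n + 1) else 1) *
       (\<Prod>j\<in>S. if n < j \<and> f j \<le> src n then 1 + \<gamma> / real (n + 1) else 1)"
    proof (cases "n \<in> S")
      case True
      have "1 \<le> (1 + \<gamma> / real (n + 1)) ^ card {j\<in>S. n < j \<and> f j \<le> src n}"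
        using \<gamma> by (intro one_le_power) auto
      then have "\<gamma> / real (n + 1) * 1 \<le> \<gamma> / real (n + 1) * (1 + \<gamma> / real (n + 1)) ^ card {j\<in>S. n < j \<and> f j \<le> src n}"
        using \<gamma> by (intro mult_left_mono) auto
      then show ?thesis unfolding eq growth_def using True by simp
    next
      case False
      then have "{j\<in>S. n \<le> j \<and> f j \<le> src n} = {j\<in>S. n < j \<and> f j \<le> src n}"
        by (auto simp: order_le_less)
      moreover have "1 + real (card {j\<in>S. n < j \<and> f j \<le> src n}) * (\<gamma> / real (n + 1))
          \<le> (1 + \<gamma> / real (n + 1)) ^ card {j\<in>S. n < j \<and> f j \<le> src n}"
      proof (rule Bernoulli_inequality)
        have "0 \<le> \<gamma> / real (n + 1)" using \<gamma> by simp
        then show "-1 \<le> \<gamma> / real (n + 1)" by linarith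
      qed
      ultimately show ?thesis unfolding eq growth_def using False by simp
    qed
  qed
  also have "\<dots> = (\<Prod>n<N. if n \<in> S then \<gamma> / real (n + 1) else 1) *
       (\<Prod>j\<in>S. \<Prod>n<N. if n < j \<and> f j \<le> src n then 1 + \<gamma> / real (n + 1) else 1)"
    unfolding prod.distrib by (subst prod.swap) simp
  also have "(\<Prod>n<N. if n \<in> S then \<gamma> / real (n + 1) else 1) = (\<Prod>n\<in>S. \<gamma> / real (n + 1))"
    using S by (simp add: prod.inter_restrict[symmetric] Int_absorb1)
  finally have "(\<Prod>n<N. growth S f n) \<le> (\<Prod>n\<in>S. \<gamma> / real (n + 1)) *
       (\<Prod>j\<in>S. \<Prod>n<N. if n < j \<and> f j \<le> src n then 1 + \<gamma> / real (n + 1) else 1)" .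
  moreover have "(\<Prod>j\<in>S. \<Prod>n<N. if n < j \<and> f j \<le> src n then 1 + \<gamma> / real (n + 1) else 1)
      \<le> (\<Prod>j\<in>S. 2 * (3 * real (j + 1) / real (f j)) powr \<gamma>)"
  proof (intro prod_mono conjI)
    fix j assume j: "j \<in> S"
    show "0 \<le> (\<Prod>n<N. if n < j \<and> f j \<le> src n then 1 + \<gamma> / real (n + 1) else 1)"
      using \<gamma> by (intro prod_nonneg) auto
    have "(\<Prod>n<N. if n < j \<and> f j \<le> src n then 1 + \<gamma> / real (n + 1) else 1)
        = (\<Prod>n<j. if f j \<le> src n then 1 + \<gamma> / real (n + 1) else 1)"
      using j S by (intro prod.mono_neutral_cong_right) auto
    also have "\<dots> \<le> (\<Prod>n<j. if f j \<le> 3 * (n + 1) then 1 + \<gamma> / real (n + 1) else 1)"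
      using \<gamma> src_le' le_trans by (intro prod_mono) (fastforce)
    also have "\<dots> \<le> 2 * (3 * real (j + 1) / real (f j)) powr \<gamma>"
      using \<gamma> f[OF j] src_le'[of j] by (intro prod_growth_le) auto
    finally show "(\<Prod>n<N. if n < j \<and> f j \<le> src n then 1 + \<gamma> / real (n + 1) else 1)
      \<le> 2 * (3 * real (j + 1) / real (f j)) powr \<gamma>" .
  qed
  then have "(\<Prod>n\<in>S. \<gamma> / real (n + 1)) * (\<Prod>j\<in>S. \<Prod>n<N. if n < j \<and> f j \<le> src n then 1 + \<gamma> / real (n + 1) else 1)
      \<le> (\<Prod>n\<in>S. \<gamma> / real (n + 1)) * (\<Prod>j\<in>S. 2 * (3 * real (j + 1) / real (f j)) powr \<gamma>)"
    using \<gamma> by (intro mult_left_mono prod_nonneg) auto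
  ultimately show ?thesis
    unfolding prod.distrib[of "\<lambda>j. \<gamma> / real (j + 1)"] by linarith
qed

text \<open>The factor W + 1 comes from the initial potential, 2 from \<open>prod_growth_le\<close>,
  and 3 from replacing \<open>j + 1\<close> by \<open>src j\<close>.\<close>

definition edge_const :: real where "edge_const = 6 * (W + 1)"

lemma edge_const_pos: "edge_const > 0"
  using W by (simp add: edge_const_def)

lemma prob_targets_le:
  assumes S: "finite S" "S \<subseteq> {..<N}" and f: "\<And>j. j \<in> S \<Longrightarrow> 1 \<le> f j \<and> f j \<le> src j"
    and f2: "\<And>a. card {j \<in> S. f j = a} \<le> 2"
  shows "measure_pmf.prob (draws K N) {xs. \<forall>j\<in>S. tgt (xs ! j) = f j}
    \<le> (\<Prod>j\<in>S. edge_const * edge_bound \<gamma> (src j) (f j))"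
proof -
  have "measure_pmf.prob (draws K N) {xs. \<forall>j\<in>S. tgt (xs ! j) = f j}
    \<le> (\<Prod>j<N. growth S f j) * potential S f 0 []"
    by (rule prob_targets_growth[OF S])
  also have "\<dots> \<le> (\<Prod>j\<in>S. \<gamma> / real (j + 1) * (2 * (3 * real (j + 1) / real (f j)) powr \<gamma>)) * (W + 1) ^ card S"
  proof (rule mult_mono)
    show "0 \<le> (\<Prod>j\<in>S. \<gamma> / real (j + 1) * (2 * (3 * real (j + 1) / real (f j)) powr \<gamma>))"
      using \<gamma> by (intro prod_nonneg) auto
  qed (use prod_growth_targets_le[OF S f] potential_0_le[OF S(1) f2] potential_nonneg in auto)
  also have "\<dots> = (\<Prod>j\<in>S. (W + 1) * (\<gamma> / real (j + 1) * (2 * (3 * real (j + 1) / real (f j)) powr \<gamma>)))"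
    by (subst prod.distrib[of "\<lambda>_. W + 1"]) (simp add: mult.commute)
  also have "\<dots> \<le> (\<Prod>j\<in>S. edge_const * edge_bound \<gamma> (src j) (f j))"
  proof (intro prod_mono conjI)
    fix j assume j: "j \<in> S"
    show "0 \<le> (W + 1) * (\<gamma> / real (j + 1) * (2 * (3 * real (j + 1) / real (f j)) powr \<gamma>))"
      using W \<gamma> by auto
    have fj: "1 \<le> f j" "f j \<le> src j" using f[OF j] by auto
    define x where "x = 3 * real (j + 1)"
    have x: "x > 0" "real (j + 1) = x / 3" by (auto simp: x_def)
    have "(x / real (f j)) powr \<gamma> / (x / 3) = 3 * x powr (\<gamma> - 1) * real (f j) powr (- \<gamma>)"
    proof -
      have "(x / real (f j)) powr \<gamma> = x powr \<gamma> / real (f j) powr \<gamma>"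
        by (rule powr_divide)
      moreover have "x powr (\<gamma> - 1) = x powr \<gamma> / x"
        using x(1) by (simp add: powr_diff)
      moreover have "real (f j) powr (- \<gamma>) = 1 / real (f j) powr \<gamma>"
        by (rule powr_minus_divide)
      ultimately show ?thesis by (simp add: mult.commute)
    qed
    then have "(3 * real (j + 1) / real (f j)) powr \<gamma> / real (j + 1)
       = 3 * (3 * real (j + 1)) powr (\<gamma> - 1) * real (f j) powr (- \<gamma>)"
      unfolding x(2)[symmetric] x_def[symmetric] .
    \<comment> \<open>The exponent \<gamma> - 1 is negative, so it is the upper bound on
      \<open>src j\<close> that is used.\<close>
    also have "\<dots> \<le> 3 * real (src j) powr (\<gamma> - 1) * real (f j) powr (- \<gamma>)"
    proof -
      have "real (src j) \<le> real (3 * (j + 1))" using src_le' by (rule of_nat_mono)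
      then have "real (src j) \<le> 3 * real (j + 1)" by simp
      moreover have "real (src j) > 0" using src_pos[of j] by simp
      ultimately show ?thesis
        using \<gamma> by (intro mult_right_mono mult_left_mono powr_mono2') auto
    qed
    also have "\<dots> = 3 * edge_bound \<gamma> (src j) (f j)"
      using fj by (simp add: edge_bound_def max_def min_def)
    finally have *: "(3 * real (j + 1) / real (f j)) powr \<gamma> / real (j + 1) \<le> 3 * edge_bound \<gamma> (src j) (f j)" .
    have "(W + 1) * (\<gamma> / real (j + 1) * (2 * (3 * real (j + 1) / real (f j)) powr \<gamma>))
       = 2 * (W + 1) * \<gamma> * ((3 * real (j + 1) / real (f j)) powr \<gamma> / real (j + 1))" by simp
    also have "\<dots> \<le> 2 * (W + 1) * 1 * (3 * edge_bound \<gamma> (src j) (f j))"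
      using W \<gamma> * by (intro mult_mono) auto
    also have "\<dots> = 6 * (W + 1) * edge_bound \<gamma> (src j) (f j)" by simp
    finally show "(W + 1) * (\<gamma> / real (j + 1) * (2 * (3 * real (j + 1) / real (f j)) powr \<gamma>))
      \<le> edge_const * edge_bound \<gamma> (src j) (f j)" unfolding edge_const_def by linarith
  qed
  finally show ?thesis .
qed

subsection \<open>Paths and loops\<close>

text \<open>A necessary condition for adjacency that depends on the draws alone. Pairs of vertices
  up to 2 always qualify, as the initial graph may join them.\<close>

definition linked :: "nat \<Rightarrow> 'a list \<Rightarrow> nat \<Rightarrow> nat \<Rightarrow> bool" where
  "linked N xs u v \<longleftrightarrow> u \<le> 2 \<and> v \<le> 2 \<or> (\<exists>n<N. src n = max u v \<and> tgt (xs ! n) = min u v)"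

text \<open>The possible origins of an edge: \<^term>\<open>None\<close> for the initial graph, or a draw.\<close>
definition origins :: "nat \<Rightarrow> nat \<Rightarrow> nat \<Rightarrow> nat option set" where
  "origins N u v = (if u \<le> 2 \<and> v \<le> 2 then {None} else {}) \<union> Some ` {n. n < N \<and> src n = max u v}"

lemma card_src_le: "card {n. n < N \<and> src n = b} \<le> 3 * m"
proof -
  have "{n. n < N \<and> src n = b} \<subseteq> {m * b - 3 * m..<m * b}"
  proof
    fix n assume "n \<in> {n. n < N \<and> src n = b}"
    then show "n \<in> {m * b - 3 * m..<m * b}" using src_gt[of n] src_le[of n] by auto
  qed
  then have "card {n. n < N \<and> src n = b} \<le> card {m * b - 3 * m..<m * b}"
    by (intro card_mono) auto
  then show ?thesis by simp
qed

lemma finite_origins: "finite (origins N u v)"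
  by (simp add: origins_def)

definition origin_weight :: "nat \<Rightarrow> nat \<Rightarrow> nat option \<Rightarrow> real" where
  "origin_weight u v x = (case x of None \<Rightarrow> 1 | Some n \<Rightarrow> edge_const * edge_bound \<gamma> u v)"

definition step_const :: real where "step_const = 2 + 3 * real m * edge_const"

text \<open>An edge of the initial graph has probability cost 1, but on vertices up to 2 the kernel
  is at least 1/2, so 2 in \<open>step_const\<close> pays for it. The other term counts the at most
  \<open>3 * m\<close> draws that can produce the edge.\<close>

lemma sum_origin_weight_le:
  assumes "1 \<le> u" "1 \<le> v"
  shows "(\<Sum>x\<in>origins N u v. origin_weight u v x) \<le> step_const * edge_bound \<gamma> u v"
proof -
  have e: "edge_bound \<gamma> u v \<ge> 0" by (rule edge_bound_nonneg)
  have "(\<Sum>x\<in>origins N u v. origin_weight u v x)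
      = (\<Sum>x\<in>(if u \<le> 2 \<and> v \<le> 2 then {None} else {}). origin_weight u v x)
        + (\<Sum>x\<in>Some ` {n. n < N \<and> src n = max u v}. origin_weight u v x)"
    unfolding origins_def by (intro sum.union_disjoint) auto
  also have "(\<Sum>x\<in>Some ` {n. n < N \<and> src n = max u v}. origin_weight u v x)
     = real (card {n. n < N \<and> src n = max u v}) * (edge_const * edge_bound \<gamma> u v)"
    by (subst sum.reindex) (auto simp: origin_weight_def)
  also have "\<dots> \<le> real (3 * m) * (edge_const * edge_bound \<gamma> u v)"
    using e edge_const_pos by (intro mult_right_mono of_nat_mono card_src_le) auto
  also have "(\<Sum>x\<in>(if u \<le> 2 \<and> v \<le> 2 then {None} else {}). origin_weight u v x) \<le> 2 * edge_bound \<gamma> u v"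
  proof (cases "u \<le> 2 \<and> v \<le> 2")
    case True
    have "2 powr (\<gamma> - 1) * 2 powr (- \<gamma>) \<le> edge_bound \<gamma> u v"
      unfolding edge_bound_def using True assms \<gamma> by (intro mult_mono powr_mono2') auto
    then show ?thesis using True by (simp add: origin_weight_def powr_add[symmetric])
  next
    case False
    then show ?thesis using e by auto
  qed
  finally show ?thesis by (simp add: step_const_def algebra_simps)
qed

text \<open>Distinctness of the vertices is used twice: different edges of the path cannot stem from
  the same draw, and each vertex is the smaller end point of at most two edges, as
  \<open>prob_targets_le\<close> demands.\<close>

lemma prob_origins_le:
  assumes p: "distinct p" "length p = Suc k" "set p \<subseteq> {1..}"
    and os: "\<And>i. i < k \<Longrightarrow> os i \<in> origins N (p ! i) (p ! Suc i)"
  shows "measure_pmf.prob (draws K N)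
      {xs. \<forall>i<k. \<forall>n. os i = Some n \<longrightarrow> tgt (xs ! n) = min (p ! i) (p ! Suc i)}
    \<le> (\<Prod>i<k. origin_weight (p ! i) (p ! Suc i) (os i))"
proof -
  let ?E = "{xs. \<forall>i<k. \<forall>n. os i = Some n \<longrightarrow> tgt (xs ! n) = min (p ! i) (p ! Suc i)}"
  define I where "I = {i. i < k \<and> os i \<noteq> None}"
  define d where "d i = the (os i)" for i
  define a where "a i = min (p ! i) (p ! Suc i)" for i
  have inj: "p ! i = p ! j \<longleftrightarrow> i = j" if "i \<le> k" "j \<le> k" for i j
    using that p by (simp add: nth_eq_iff_index_eq)
  have pos: "p ! i \<ge> 1" if "i \<le> k" for i
    using that p nth_mem[of i p] by (force simp del: nth_mem)
  have E_eq: "?E = {xs. \<forall>i\<in>I. tgt (xs ! d i) = a i}"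
    by (auto simp: I_def d_def a_def)
  have dI: "d i < N" "src (d i) = max (p ! i) (p ! Suc i)" if "i \<in> I" for i
    using that os[of i] by (auto simp: I_def d_def origins_def split: if_splits)
  have w: "(\<Prod>i<k. origin_weight (p ! i) (p ! Suc i) (os i)) = (\<Prod>i\<in>I. edge_const * edge_bound \<gamma> (p ! i) (p ! Suc i))"
    by (rule prod.mono_neutral_cong_right) (auto simp: I_def origin_weight_def)
  show ?thesis
  proof (cases "inj_on d I")
    \<comment> \<open>If two edges shared a draw, they would have the same maximum and minimum and
      thus be the same edge of a self-avoiding path; the event is empty.\<close>
    case False
    then obtain i j where ij: "i \<in> I" "j \<in> I" "d i = d j" "i \<noteq> j" by (auto simp: inj_on_def)
    have k: "i < k" "j < k" using ij by (auto simp: I_def)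
    have "xs \<notin> ?E" for xs
    proof
      assume "xs \<in> ?E"
      then have "tgt (xs ! d i) = a i" "tgt (xs ! d j) = a j" unfolding E_eq using ij(1,2) by auto
      then have "a i = a j" using ij(3) by simp
      moreover have "max (p ! i) (p ! Suc i) = max (p ! j) (p ! Suc j)"
        using dI(2)[OF ij(1)] dI(2)[OF ij(2)] ij(3) by simp
      ultimately have "p ! i = p ! j \<or> p ! i = p ! Suc j \<and> p ! Suc i = p ! j"
        unfolding a_def by (auto simp: min_def max_def split: if_splits)
      then show False using inj[of i j] inj[of i "Suc j"] inj[of "Suc i" j] k ij(4) by auto
    qed
    then have "?E = {}" by blast
    then show ?thesis unfolding w
      by (simp only: measure_empty) (intro prod_nonneg mult_nonneg_nonneg edge_bound_nonneg less_imp_le[OF edge_const_pos])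
  next
    case True
    define S where "S = d ` I"
    define f where "f j = a (inv_into I d j)" for j
    have fd: "f (d i) = a i" if "i \<in> I" for i
      using True that by (simp add: f_def)
    have "?E = {xs. \<forall>j\<in>S. tgt (xs ! j) = f j}"
      unfolding E_eq S_def by (auto simp: fd)
    also have "measure_pmf.prob (draws K N) \<dots> \<le> (\<Prod>j\<in>S. edge_const * edge_bound \<gamma> (src j) (f j))"
    proof (rule prob_targets_le)
      show "finite S" by (simp add: S_def I_def)
      show "S \<subseteq> {..<N}" using dI by (auto simp: S_def)
      show "1 \<le> f j \<and> f j \<le> src j" if j: "j \<in> S" for j
      proof -
        obtain i where i: "i \<in> I" "j = d i" using j by (auto simp: S_def)
        then have "i < k" by (simp add: I_def)
        then show ?thesis using pos[of i] pos[of "Suc i"] i dI(2)[OF i(1)] fd[OF i(1)]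
          by (auto simp: a_def min_def max_def)
      qed
      show "card {j \<in> S. f j = b} \<le> 2" for b
      proof -
        let ?A = "{i. i < k \<and> p ! i = b}" and ?B = "{i. i < k \<and> p ! Suc i = b}"
        have "x = y" if "x \<in> ?A" "y \<in> ?A" for x y
          using inj[of x y] that by simp
        then have "card ?A \<le> Suc 0" by (simp add: card_le_Suc0_iff_eq)
        moreover have "x = y" if "x \<in> ?B" "y \<in> ?B" for x y
          using inj[of "Suc x" "Suc y"] that by simp
        then have "card ?B \<le> Suc 0" by (simp add: card_le_Suc0_iff_eq)
        moreover have "{j \<in> S. f j = b} \<subseteq> d ` (?A \<union> ?B)"
        proof
          fix j assume "j \<in> {j \<in> S. f j = b}"
          then obtain i where i: "i \<in> I" "j = d i" "a i = b" using fd by (auto simp: S_def)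
          then have "i \<in> ?A \<union> ?B" by (auto simp: a_def I_def min_def split: if_splits)
          then show "j \<in> d ` (?A \<union> ?B)" using i by blast
        qed
        then have "card {j \<in> S. f j = b} \<le> card (?A \<union> ?B)"
          by (intro surj_card_le) auto
        moreover have "card (?A \<union> ?B) \<le> card ?A + card ?B" by (rule card_Un_le)
        ultimately show ?thesis by linarith
      qed
    qed
    also have "\<dots> = (\<Prod>i\<in>I. edge_const * edge_bound \<gamma> (src (d i)) (a i))"
      unfolding S_def using True by (subst prod.reindex) (auto simp: fd)
    also have "\<dots> = (\<Prod>i\<in>I. edge_const * edge_bound \<gamma> (p ! i) (p ! Suc i))"
      by (intro prod.cong refl) (auto simp: dI a_def edge_bound_def max_def min_def)
    finally show ?thesis unfolding w .
  qed
qed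

text \<open>A union bound over the origins of all edges; the resulting sum of products factorizes
  into a product over the edges.\<close>

lemma prob_path_le:
  assumes p: "distinct p" "length p = Suc k" "set p \<subseteq> {1..}"
  shows "measure_pmf.prob (draws K N) {xs. \<forall>i<k. linked N xs (p ! i) (p ! Suc i)}
    \<le> (\<Prod>i<k. step_const * edge_bound \<gamma> (p ! i) (p ! Suc i))"
proof -
  let ?O = "\<lambda>i. origins N (p ! i) (p ! Suc i)"
  let ?E = "\<lambda>os. {xs. \<forall>i<k. \<forall>n. os i = Some n \<longrightarrow> tgt (xs ! n) = min (p ! i) (p ! Suc i)}"
  have "{xs. \<forall>i<k. linked N xs (p ! i) (p ! Suc i)} \<subseteq> (\<Union>os\<in>PiE {..<k} ?O. ?E os)"
  proof
    fix xs assume "xs \<in> {xs. \<forall>i<k. linked N xs (p ! i) (p ! Suc i)}"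
    then have "\<forall>i\<in>{..<k}. \<exists>x. x \<in> ?O i \<and> (\<forall>n. x = Some n \<longrightarrow> tgt (xs ! n) = min (p ! i) (p ! Suc i))"
      unfolding linked_def origins_def by fastforce
    then obtain os where os: "\<And>i. i \<in> {..<k} \<Longrightarrow> os i \<in> ?O i \<and> (\<forall>n. os i = Some n \<longrightarrow> tgt (xs ! n) = min (p ! i) (p ! Suc i))"
      by metis
    then have "restrict os {..<k} \<in> PiE {..<k} ?O" "xs \<in> ?E (restrict os {..<k})" by auto
    then show "xs \<in> (\<Union>os\<in>PiE {..<k} ?O. ?E os)" by blast
  qed
  then have "measure_pmf.prob (draws K N) {xs. \<forall>i<k. linked N xs (p ! i) (p ! Suc i)}
     \<le> measure_pmf.prob (draws K N) (\<Union>os\<in>PiE {..<k} ?O. ?E os)"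
    by (intro measure_pmf.finite_measure_mono) auto
  also have "\<dots> \<le> (\<Sum>os\<in>PiE {..<k} ?O. measure_pmf.prob (draws K N) (?E os))"
    by (intro measure_pmf.finite_measure_subadditive_finite finite_PiE finite_origins) auto
  also have "\<dots> \<le> (\<Sum>os\<in>PiE {..<k} ?O. \<Prod>i<k. origin_weight (p ! i) (p ! Suc i) (os i))"
    by (intro sum_mono prob_origins_le p) (auto simp: PiE_iff)
  also have "\<dots> = (\<Prod>i<k. \<Sum>x\<in>?O i. origin_weight (p ! i) (p ! Suc i) x)"
    by (rule prod_sum_PiE[symmetric]) (auto intro: finite_origins)
  also have "\<dots> \<le> (\<Prod>i<k. step_const * edge_bound \<gamma> (p ! i) (p ! Suc i))"
  proof (intro prod_mono conjI sum_origin_weight_le)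
    fix i assume "i \<in> {..<k}"
    then have "p ! i \<in> {1..}" "p ! Suc i \<in> {1..}" using p nth_mem[of i p] nth_mem[of "Suc i" p] by (auto simp del: nth_mem)
    then show "1 \<le> p ! i" "1 \<le> p ! Suc i" by auto
    show "0 \<le> (\<Sum>x\<in>?O i. origin_weight (p ! i) (p ! Suc i) x)"
      using edge_const_pos by (intro sum_nonneg) (auto simp: origin_weight_def edge_bound_nonneg split: option.splits)
  qed
  finally show ?thesis .
qed

section \<open>Expected numbers of short paths and of loops\<close>

definition increasing_paths :: "nat \<Rightarrow> nat \<Rightarrow> nat list set" where
  "increasing_paths t k = {p. set p \<subseteq> {1..t} \<and> length p = Suc k \<and> distinct p \<and> hd p \<le> last p}"

definition num_paths :: "nat \<Rightarrow> nat \<Rightarrow> nat \<Rightarrow> 'a list \<Rightarrow> real" where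
  "num_paths N t k xs = (\<Sum>l\<le>k. \<Sum>p\<in>increasing_paths t l.
     indicator {xs. \<forall>i<l. linked N xs (p ! i) (p ! Suc i)} xs)"

definition num_loops :: "nat \<Rightarrow> 'a list \<Rightarrow> real" where
  "num_loops N xs = (\<Sum>n<N. indicator {xs. tgt (xs ! n) = src n} xs)"

lemma finite_increasing_paths: "finite (increasing_paths t k)"
  by (rule finite_subset[OF _ finite_lists_length_eq[of "{1..t}" "Suc k"]]) (auto simp: increasing_paths_def)

lemma num_paths_nonneg: "num_paths N t k xs \<ge> 0"
  by (auto simp: num_paths_def intro!: sum_nonneg)

lemma num_loops_nonneg: "num_loops N xs \<ge> 0"
  by (auto simp: num_loops_def intro!: sum_nonneg)

lemma integrable_indicator_pmf: "integrable (measure_pmf M) (\<lambda>x. indicator A x :: real)"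
  by (intro measure_pmf.integrable_const_bound[where B = 1]) auto

lemma integrable_num_paths: "integrable (measure_pmf (draws K N)) (num_paths N t k)"
  unfolding num_paths_def by (intro Bochner_Integration.integrable_sum integrable_indicator_pmf)

lemma integrable_num_loops: "integrable (measure_pmf (draws K N)) (num_loops N)"
  unfolding num_loops_def by (intro Bochner_Integration.integrable_sum integrable_indicator_pmf)

text \<open>The summand 2 makes the geometric sum up to \<open>k\<close> at most the next power, and
  the logarithm of the base positive.\<close>

definition path_base :: real where "path_base = step_const * (2 / (1/2 - \<gamma>)) + 2"

lemma step_const_pos: "step_const > 0"
  using edge_const_pos by (auto simp: step_const_def intro!: add_pos_nonneg)

lemma path_base_ge: "path_base \<ge> 2"
  using step_const_pos \<gamma> by (simp add: path_base_def)

text \<open>As only paths with \<^term>\<open>hd p \<le> last p\<close> are counted, the factor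
  \<^term>\<open>sqrt (real (last p) / real (hd p))\<close> required for summing over paths is free.\<close>
lemma expectation_num_paths_le:
  "measure_pmf.expectation (draws K N) (num_paths N t k) \<le> path_base ^ Suc k * real t"
proof -
  let ?C = "step_const * (2 / (1/2 - \<gamma>))"
  have "measure_pmf.expectation (draws K N) (num_paths N t k)
     = (\<Sum>l\<le>k. \<Sum>p\<in>increasing_paths t l. measure_pmf.prob (draws K N) {xs. \<forall>i<l. linked N xs (p ! i) (p ! Suc i)})"
    unfolding num_paths_def
    by (simp add: Bochner_Integration.integral_sum Bochner_Integration.integrable_sum integrable_indicator_pmf)
  also have "\<dots> \<le> (\<Sum>l\<le>k. ?C ^ l * real t)"
  proof (intro sum_mono)
    fix l
    have "(\<Sum>p\<in>increasing_paths t l. measure_pmf.prob (draws K N) {xs. \<forall>i<l. linked N xs (p ! i) (p ! Suc i)})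
      \<le> (\<Sum>p\<in>increasing_paths t l. real (hd p) powr (- 1/2) * real (last p) powr (1/2) *
            (\<Prod>i<l. step_const * edge_bound \<gamma> (p ! i) (p ! Suc i)))"
    proof (intro sum_mono)
      fix p assume p: "p \<in> increasing_paths t l"
      let ?w = "\<Prod>i<l. step_const * edge_bound \<gamma> (p ! i) (p ! Suc i)"
      have w: "?w \<ge> 0" using step_const_pos by (intro prod_nonneg) (auto simp: edge_bound_nonneg)
      have "hd p \<in> {1..t}" using p by (cases p) (auto simp: increasing_paths_def)
      then have "real (hd p) powr (- 1/2) * real (hd p) powr (1/2) = 1"
        by (simp add: powr_add[symmetric])
      moreover have "real (hd p) powr (- 1/2) * real (hd p) powr (1/2) \<le> real (hd p) powr (- 1/2) * real (last p) powr (1/2)"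
        using p by (intro mult_left_mono powr_mono2) (auto simp: increasing_paths_def)
      ultimately have "1 * ?w \<le> real (hd p) powr (- 1/2) * real (last p) powr (1/2) * ?w"
        using w by (intro mult_right_mono) auto
      moreover have "measure_pmf.prob (draws K N) {xs. \<forall>i<l. linked N xs (p ! i) (p ! Suc i)} \<le> ?w"
        using p by (intro prob_path_le) (auto simp: increasing_paths_def)
      ultimately show "measure_pmf.prob (draws K N) {xs. \<forall>i<l. linked N xs (p ! i) (p ! Suc i)}
         \<le> real (hd p) powr (- 1/2) * real (last p) powr (1/2) * ?w" by linarith
    qed
    also have "\<dots> \<le> (\<Sum>p | set p \<subseteq> {1..t} \<and> length p = Suc l. real (hd p) powr (- 1/2) * real (last p) powr (1/2) *
            (\<Prod>i<l. step_const * edge_bound \<gamma> (p ! i) (p ! Suc i)))"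
      using step_const_pos finite_lists_length_eq[of "{1..t}" "Suc l"]
      by (intro sum_mono2) (auto simp: increasing_paths_def edge_bound_nonneg intro!: mult_nonneg_nonneg prod_nonneg)
    also have "\<dots> \<le> ?C ^ l * real t"
      using \<gamma> step_const_pos by (intro sum_path_weight_le) auto
    finally show "(\<Sum>p\<in>increasing_paths t l. measure_pmf.prob (draws K N) {xs. \<forall>i<l. linked N xs (p ! i) (p ! Suc i)})
       \<le> ?C ^ l * real t" .
  qed
  also have "\<dots> \<le> (\<Sum>l\<le>k. path_base ^ l * real t)"
    using step_const_pos \<gamma> by (intro sum_mono mult_right_mono power_mono) (auto simp: path_base_def)
  also have "\<dots> = (\<Sum>l\<le>k. path_base ^ l) * real t" by (rule sum_distrib_right[symmetric])
  also have "(\<Sum>l\<le>k. path_base ^ l) \<le> path_base ^ Suc k"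
  proof (induction k)
    case (Suc k)
    have "(\<Sum>l\<le>Suc k. path_base ^ l) \<le> 2 * path_base ^ Suc k" using Suc by simp
    also have "\<dots> \<le> path_base * path_base ^ Suc k"
      using path_base_ge by (intro mult_right_mono) auto
    finally show ?case by simp
  qed (use path_base_ge in simp)
  finally show ?thesis by (simp add: mult_right_mono)
qed

text \<open>A loop is the case of a single prescribed draw, and the kernel on the diagonal is 1/v
  with v at least (n + 1)/m. After merging, edges inside a block are loops as well and are counted
  here.\<close>

lemma expectation_num_loops_le:
  "measure_pmf.expectation (draws K N) (num_loops N) \<le> edge_const * real m * harm N"
proof -
  have "measure_pmf.expectation (draws K N) (num_loops N)
     = (\<Sum>n<N. measure_pmf.prob (draws K N) {xs. tgt (xs ! n) = src n})"
    unfolding num_loops_def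
    by (simp add: Bochner_Integration.integral_sum integrable_indicator_pmf)
  also have "\<dots> \<le> (\<Sum>n<N. edge_const * real m * inverse (real (n + 1)))"
  proof (intro sum_mono)
    fix n assume n: "n \<in> {..<N}"
    have card: "card {j \<in> {n}. src j = a} \<le> 2" for a
      by (rule order_trans[OF card_mono[of "{n}"]]) auto
    have "measure_pmf.prob (draws K N) {xs. tgt (xs ! n) = src n} \<le> edge_const * edge_bound \<gamma> (src n) (src n)"
      using prob_targets_le[of "{n}" N src] n src_pos card by auto
    also have "edge_bound \<gamma> (src n) (src n) = inverse (real (src n))"
      using src_pos[of n] powr_minus[of "real (src n)" 1] by (simp add: edge_bound_def powr_add[symmetric])
    also have "\<dots> \<le> real m * inverse (real (n + 1))"
    proof -
      have "real (n + 1) \<le> real (m * src n)" using src_gt[of n] by (intro of_nat_mono) simp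
      then show ?thesis using src_pos[of n] by (simp add: field_simps)
    qed
    finally show "measure_pmf.prob (draws K N) {xs. tgt (xs ! n) = src n} \<le> edge_const * real m * inverse (real (n + 1))"
      using edge_const_pos by (simp add: mult.assoc mult_left_mono)
  qed
  also have "\<dots> = edge_const * real m * harm N"
    unfolding harm_def sum_distrib_left[symmetric]
    by (simp add: sum.atLeast1_atMost_eq atLeast0LessThan)
  finally show ?thesis .
qed

subsection \<open>The lower bound\<close>

lemma linked_edge:
  assumes "realizes tgt src t N xs G" "xs \<in> set_pmf (draws K N)" "Upair u v \<in># edges G"
  shows "linked N xs u v"
proof -
  consider "u \<le> 2 \<and> v \<le> 2" | n where "n < N" "Upair u v = Upair (src n) (tgt (xs ! n))"
    using assms unfolding realizes_def by blast
  then show ?thesis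
  proof cases
    case (2 n)
    then have "src n = max u v \<and> tgt (xs ! n) = min u v"
      using tgt_nth_bounds(2)[OF assms(2) 2(1)] by (auto simp: max_def min_def)
    then show ?thesis using 2 by (auto simp: linked_def)
  qed (simp add: linked_def)
qed

text \<open>The vertices at which a descent from source to target may come to a halt;
  \<open>connected_to_root\<close> shows that each component contains one.\<close>

definition roots :: "nat \<Rightarrow> 'a list \<Rightarrow> nat set" where
  "roots N xs = {1, 2} \<union> src ` {n. n < N \<and> tgt (xs ! n) = src n}"

lemma card_roots_le: "real (card (roots N xs)) \<le> 2 + num_loops N xs"
proof -
  have "card (roots N xs) \<le> card {1, 2 :: nat} + card (src ` {n. n < N \<and> tgt (xs ! n) = src n})"
    unfolding roots_def by (rule card_Un_le)
  also have "\<dots> \<le> 2 + card {n. n < N \<and> tgt (xs ! n) = src n}"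
    by (intro add_mono card_image_le) auto
  finally have "real (card (roots N xs)) \<le> real (2 + card {n. n < N \<and> tgt (xs ! n) = src n})"
    by (rule of_nat_mono)
  moreover have "num_loops N xs = (\<Sum>n<N. if tgt (xs ! n) = src n then 1 else 0)"
    unfolding num_loops_def by (intro sum.cong) auto
  then have "num_loops N xs = real (card {n. n < N \<and> tgt (xs ! n) = src n})"
    by (subst (asm) sum.inter_filter[symmetric]) auto
  ultimately show ?thesis by simp
qed

lemma connected_to_root:
  assumes G: "realizes tgt src t N xs G" "xs \<in> set_pmf (draws K N)"
    and cover: "\<And>v. 3 \<le> v \<Longrightarrow> v \<le> t \<Longrightarrow> \<exists>n<N. src n = v"
    and v: "v \<in> {1..t}"
  shows "\<exists>r\<in>roots N xs. \<exists>p. connected_by G p v r"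
  using v
proof (induction v rule: less_induct)
  case (less v)
  have v: "v \<in> verts G" using less.prems G(1) by (simp add: realizes_def)
  then have self: "connected_by G [v] v v" by (simp add: connected_by_def walk_def)
  show ?case
  proof (cases "v \<le> 2")
    case True
    then have "v \<in> roots N xs" using less.prems by (auto simp: roots_def)
    then show ?thesis using self by blast
  next
    case False
    then obtain n where n: "n < N" "src n = v" using cover[of v] less.prems by auto
    let ?w = "tgt (xs ! n)"
    have w: "1 \<le> ?w" "?w \<le> v" using tgt_nth_bounds[OF G(2) n(1)] n(2) by auto
    show ?thesis
    proof (cases "?w = v")
      case True
      then have "v \<in> roots N xs"
        unfolding roots_def using n by (intro UnI2 image_eqI[of _ _ n]) auto
      then show ?thesis using self by blast
    next
      case False
      then obtain r p where rp: "r \<in> roots N xs" "connected_by G p ?w r"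
        using less.IH[of ?w] w less.prems by auto
      have "Upair v ?w \<in># edges G" using G(1) n by (auto simp: realizes_def)
      then have "connected_by G (v # p) v r"
        using rp(2) v by (cases p) (auto simp: connected_by_def walk_def)
      then show ?thesis using rp(1) by blast
    qed
  qed
qed

text \<open>By the pigeonhole principle some component has at least \<open>t\<close> divided by the number of roots
  vertices, and all its pairs of vertices are joined by short paths.\<close>
lemma square_le_of_diam_le:
  assumes G: "realizes tgt src t N xs G" "xs \<in> set_pmf (draws K N)"
    and cover: "\<And>v. 3 \<le> v \<Longrightarrow> v \<le> t \<Longrightarrow> \<exists>n<N. src n = v"
    and diam: "diam G \<le> k"
  shows "real t ^ 2 \<le> 2 * num_paths N t k xs * (2 + num_loops N xs) ^ 2"
proof -
  obtain r where r: "\<And>v. v \<in> {1..t} \<Longrightarrow> r v \<in> roots N xs \<and> (\<exists>p. connected_by G p v (r v))"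
    using connected_to_root[OF G cover] by metis
  let ?R = "roots N xs"
  define F where "F b = {v \<in> {1..t}. r v = b}" for b
  define s where "s = Max ((\<lambda>b. card (F b)) ` ?R)"
  have R: "finite ?R" "?R \<noteq> {}" by (auto simp: roots_def)
  have "t = (\<Sum>b\<in>?R. card (F b))"
    using sum.group[of "{1..t}" ?R r "\<lambda>_. 1::nat"] R r by (auto simp: F_def image_subset_iff)
  also have "\<dots> \<le> card ?R * s"
    using sum_bounded_above[of ?R "\<lambda>b. card (F b)" s] R by (auto simp: s_def)
  finally have ts: "t \<le> card ?R * s" .
  have "s \<in> (\<lambda>b. card (F b)) ` ?R" unfolding s_def using R by (intro Max_in) auto
  then obtain b where b: "s = card (F b)" by auto
  define P where "P = (\<Union>l\<le>k. {p\<in>increasing_paths t l. \<forall>i<l. linked N xs (p ! i) (p ! Suc i)})"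
  have finP: "finite P" unfolding P_def by (auto intro: finite_subset[OF _ finite_increasing_paths])
  have P: "\<exists>p\<in>P. hd p = u \<and> last p = v" if uv: "u \<in> F b" "v \<in> F b" "u \<le> v" for u v
  proof -
    obtain p q where "connected_by G p u b" "connected_by G q v b"
      using r[of u] r[of v] uv by (auto simp: F_def)
    then have "connected_by G (p @ tl (rev q)) u v"
      by (intro connected_by_append connected_by_rev)
    moreover have "finite (verts G)" using G(1) by (simp add: realizes_def)
    ultimately obtain p where p: "connected_by G p u v" "distinct p" "length p \<le> Suc k"
      using connected_by_diam diam by (meson Suc_le_mono le_trans)
    have ne: "p \<noteq> []" using p(1) by (auto simp: connected_by_def walk_def)
    define l where "l = length p - 1"
    have l: "length p = Suc l" "l \<le> k" using ne p(3) by (auto simp: l_def Suc_le_eq)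
    have "p \<in> increasing_paths t l"
      using p l uv G(1) by (auto simp: increasing_paths_def connected_by_def walk_def realizes_def)
    moreover have "linked N xs (p ! i) (p ! Suc i)" if "i < l" for i
    proof (rule linked_edge[OF G])
      show "Upair (p ! i) (p ! Suc i) \<in># edges G"
        using p(1) that l by (auto simp: connected_by_def walk_def successively_conv_nth)
    qed
    ultimately have "p \<in> P" using l by (auto simp: P_def)
    then show ?thesis using p(1) by (auto simp: connected_by_def)
  qed
  \<comment> \<open>Counted paths join ordered pairs u \<le> v only; the reversed pairs are the
    second image and account for the factor 2.\<close>
  have "F b \<times> F b \<subseteq> (\<lambda>p. (hd p, last p)) ` P \<union> (\<lambda>p. (last p, hd p)) ` P"
  proof
    fix z assume "z \<in> F b \<times> F b"
    then obtain u v where z: "z = (u, v)" "u \<in> F b" "v \<in> F b" by auto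
    show "z \<in> (\<lambda>p. (hd p, last p)) ` P \<union> (\<lambda>p. (last p, hd p)) ` P"
      using P[of u v] P[of v u] z by (cases "u \<le> v") (fastforce simp: image_iff)+
  qed
  then have "card (F b \<times> F b) \<le> card ((\<lambda>p. (hd p, last p)) ` P \<union> (\<lambda>p. (last p, hd p)) ` P)"
    using finP by (intro card_mono) auto
  also have "\<dots> \<le> card P + card P"
    by (rule order_trans[OF card_Un_le]) (intro add_mono card_image_le finP)
  finally have ss: "real (s ^ 2) \<le> real (2 * card P)"
    by (intro of_nat_mono) (simp add: b card_cartesian_product power2_eq_square)
  have "card P \<le> (\<Sum>l\<le>k. card {p\<in>increasing_paths t l. \<forall>i<l. linked N xs (p ! i) (p ! Suc i)})"
    unfolding P_def by (rule card_UN_le) simp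
  also have "real \<dots> = num_paths N t k xs"
    unfolding num_paths_def of_nat_sum
  proof (intro sum.cong refl)
    fix l
    have "(\<Sum>p\<in>increasing_paths t l. indicator {xs. \<forall>i<l. linked N xs (p ! i) (p ! Suc i)} xs :: real)
      = (\<Sum>p\<in>increasing_paths t l. if \<forall>i<l. linked N xs (p ! i) (p ! Suc i) then 1 else 0)"
      by (intro sum.cong) auto
    also have "\<dots> = real (card {p\<in>increasing_paths t l. \<forall>i<l. linked N xs (p ! i) (p ! Suc i)})"
      by (subst sum.inter_filter[symmetric]) (auto simp: finite_increasing_paths)
    finally show "real (card {p\<in>increasing_paths t l. \<forall>i<l. linked N xs (p ! i) (p ! Suc i)})
      = (\<Sum>p\<in>increasing_paths t l. indicator {xs. \<forall>i<l. linked N xs (p ! i) (p ! Suc i)} xs)" by simp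
  qed
  finally have cP: "real (card P) \<le> num_paths N t k xs" by simp
  have "real t \<le> real (card ?R) * real s" using ts by (metis of_nat_mono of_nat_mult)
  then have "real t ^ 2 \<le> (real (card ?R) * real s) ^ 2" by (intro power_mono) auto
  also have "\<dots> = real (s ^ 2) * real (card ?R) ^ 2" by (simp add: power_mult_distrib)
  also have "\<dots> \<le> (2 * num_paths N t k xs) * (2 + num_loops N xs) ^ 2"
    using ss cP card_roots_le[of N xs] num_paths_nonneg[of N t k xs] by (intro mult_mono power_mono) auto
  finally show ?thesis .
qed

lemma prob_ge_le:
  assumes "integrable (measure_pmf M) f" "\<And>x. f x \<ge> 0" "c > 0"
  shows "measure_pmf.prob M {x. c \<le> f x} \<le> measure_pmf.expectation M f / c"
  using integral_Markov_inequality_measure[OF assms(1), of "{}" c] assms(2,3) by simp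

lemma prob_small_diam_le:
  assumes cover: "\<And>v. 3 \<le> v \<Longrightarrow> v \<le> t \<Longrightarrow> \<exists>n<N. src n = v"
    and N: "1 \<le> N" "N \<le> m * t" and t: "t \<ge> 2" and c: "c = 1 / (4 * ln path_base)"
  shows "measure_pmf.prob (draws K N) {xs. \<exists>G. realizes tgt src t N xs G \<and> real (diam G) < c * ln (real t)}
    \<le> 2 * path_base / real t powr (1/2)
       + (2 + edge_const * real m * (ln (real (m * t)) + 1)) / real t powr (1/8)"
proof -
  define k where "k = nat \<lfloor>c * ln (real t)\<rfloor>"
  have pb: "ln path_base > 0" using path_base_ge by simp
  have cpos: "c * ln (real t) \<ge> 0" using pb t by (simp add: c)
  let ?A = "{xs. real t powr (7/4) / 2 \<le> num_paths N t k xs}"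
  let ?B = "{xs. real t powr (1/8) \<le> 2 + num_loops N xs}"
  let ?M = "measure_pmf (draws K N)"
  have "AE xs in ?M. xs \<in> {xs. \<exists>G. realizes tgt src t N xs G \<and> real (diam G) < c * ln (real t)} \<longrightarrow> xs \<in> ?A \<union> ?B"
  proof (intro AE_pmfI impI, rule ccontr)
    fix xs assume xs: "xs \<in> set_pmf (draws K N)" "xs \<notin> ?A \<union> ?B"
      and "xs \<in> {xs. \<exists>G. realizes tgt src t N xs G \<and> real (diam G) < c * ln (real t)}"
    then obtain G where G: "realizes tgt src t N xs G" "real (diam G) < c * ln (real t)" by auto
    have "diam G \<le> k" using G(2) unfolding k_def by linarith
    then have "real t ^ 2 \<le> 2 * num_paths N t k xs * (2 + num_loops N xs) ^ 2"
      by (intro square_le_of_diam_le[OF G(1) xs(1)] cover)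
    also have "\<dots> \<le> 2 * num_paths N t k xs * (real t powr (1/8)) ^ 2"
      using xs(2) num_loops_nonneg[of N xs] num_paths_nonneg[of N t k xs]
      by (intro mult_left_mono power_mono) auto
    also have "\<dots> < real t powr (7/4) * (real t powr (1/8)) ^ 2"
      using xs(2) t by (intro mult_strict_right_mono) auto
    also have "\<dots> = real t powr (7/4) * (real t powr (1/8) * real t powr (1/8))"
      by (simp add: power2_eq_square)
    also have "\<dots> = real t powr 2" by (simp only: powr_add[symmetric]) simp
    also have "\<dots> = real t ^ 2" using t by simp
    finally show False by simp
  qed
  then have "measure_pmf.prob (draws K N) {xs. \<exists>G. realizes tgt src t N xs G \<and> real (diam G) < c * ln (real t)}
     \<le> measure_pmf.prob (draws K N) (?A \<union> ?B)"
    by (intro measure_pmf.finite_measure_mono_AE) auto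
  also have "\<dots> \<le> measure_pmf.prob (draws K N) ?A + measure_pmf.prob (draws K N) ?B"
    by (rule measure_Un_le) auto
  also have "measure_pmf.prob (draws K N) ?A \<le> measure_pmf.expectation (draws K N) (num_paths N t k) / (real t powr (7/4) / 2)"
    using t by (intro prob_ge_le integrable_num_paths num_paths_nonneg) auto
  also have "\<dots> \<le> (path_base * real t powr (1/4) * real t) / (real t powr (7/4) / 2)"
  proof (intro divide_right_mono order_trans[OF expectation_num_paths_le] mult_right_mono)
    have "path_base ^ k = path_base powr real k" using path_base_ge by (simp add: powr_realpow)
    also have "\<dots> \<le> path_base powr (c * ln (real t))"
      using path_base_ge cpos unfolding k_def by (intro powr_mono) auto
    also have "\<dots> = exp (ln (real t) * (1/4))" using pb path_base_ge by (simp add: powr_def c)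
    also have "\<dots> = real t powr (1/4)" using t by (simp add: powr_def mult.commute)
    finally show "path_base ^ Suc k \<le> path_base * real t powr (1/4)"
      using path_base_ge by simp
  qed auto
  also have "\<dots> = 2 * path_base / real t powr (1/2)"
  proof -
    have "real t powr (7/4) = real t powr (1/4) * real t * real t powr (1/2)"
      using t powr_add[of "real t" "1/4 + 1" "1/2"] powr_add[of "real t" "1/4" 1] by simp
    then show ?thesis using t by simp
  qed
  also have "measure_pmf.prob (draws K N) ?B \<le> measure_pmf.expectation (draws K N) (\<lambda>xs. 2 + num_loops N xs) / real t powr (1/8)"
    using t num_loops_nonneg by (intro prob_ge_le Bochner_Integration.integrable_add integrable_num_loops) (auto intro: add_nonneg_nonneg)
  also have "\<dots> \<le> (2 + edge_const * real m * (ln (real (m * t)) + 1)) / real t powr (1/8)"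
  proof (intro divide_right_mono)
    have "measure_pmf.expectation (draws K N) (\<lambda>xs. 2 + num_loops N xs) = 2 + measure_pmf.expectation (draws K N) (num_loops N)"
      by (subst Bochner_Integration.integral_add) (auto intro: integrable_num_loops)
    also have "\<dots> \<le> 2 + edge_const * real m * harm N" using expectation_num_loops_le by simp
    also have "\<dots> \<le> 2 + edge_const * real m * (ln (real (m * t)) + 1)"
    proof -
      have "harm N \<le> ln (real N) + 1" using euler_mascheroni_sequence_decreasing[of 1 N] N by (simp add: harm_expand)
      also have "\<dots> \<le> ln (real (m * t)) + 1" using N by (intro add_right_mono ln_mono of_nat_mono) (auto simp: of_nat_0_less_iff simp del: of_nat_mult)
      finally show ?thesis using edge_const_pos by (intro add_left_mono mult_left_mono) auto
    qed
    finally show "measure_pmf.expectation (draws K N) (\<lambda>xs. 2 + num_loops N xs)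
       \<le> 2 + edge_const * real m * (ln (real (m * t)) + 1)" .
  qed auto
  finally show ?thesis by simp
qed

text \<open>Times below 3 are irrelevant in the limit and are left out because the models carry a
  conventional initial graph there. From time 3 on there is at least one draw, as the harmonic bound
  requires.\<close>

theorem diam_whp:
  assumes cover: "\<And>t v. 3 \<le> v \<Longrightarrow> v \<le> t \<Longrightarrow> \<exists>n<N t. src n = v"
    and N: "\<And>t. N t \<le> m * t"
    and P: "\<And>t. t \<ge> 3 \<Longrightarrow> P t = map_pmf (g t) (draws K (N t))"
    and g: "\<And>t xs. t \<ge> 3 \<Longrightarrow> xs \<in> set_pmf (draws K (N t)) \<Longrightarrow> realizes tgt src t (N t) xs (g t xs)"
  shows "\<exists>c>0. with_high_probability P (\<lambda>t G. c * ln (real t) \<le> real (diam G))"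
proof -
  define c where "c = 1 / (4 * ln path_base)"
  have pb: "ln path_base > 0" using path_base_ge by simp
  let ?b = "\<lambda>t. 2 * path_base / real t powr (1/2)
       + (2 + edge_const * real m * (ln (real (m * t)) + 1)) / real t powr (1/8)"
  have lower: "1 - ?b t \<le> measure_pmf.prob (P t) {G. c * ln (real t) \<le> real (diam G)}" if t: "t \<ge> 3" for t
  proof -
    have "\<exists>n<N t. src n = 3" using cover[of 3 t] t by simp
    then have N1: "1 \<le> N t" by auto
    let ?S = "{xs. c * ln (real t) \<le> real (diam (g t xs))}"
    have "measure_pmf.prob (draws K (N t)) (- ?S)
      \<le> measure_pmf.prob (draws K (N t)) {xs. \<exists>G. realizes tgt src t (N t) xs G \<and> real (diam G) < c * ln (real t)}"
      using g[OF t] by (intro measure_pmf.finite_measure_mono_AE AE_pmfI) (auto simp: not_le)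
    also have "\<dots> \<le> ?b t"
      using t by (intro prob_small_diam_le cover N1 N c_def) auto
    finally have "1 - ?b t \<le> measure_pmf.prob (draws K (N t)) ?S"
      using measure_pmf.prob_compl[of ?S "draws K (N t)"] by (simp add: Compl_eq_Diff_UNIV)
    also have "\<dots> = measure_pmf.prob (P t) {G. c * ln (real t) \<le> real (diam G)}"
      by (simp add: P[OF t] vimage_def)
    finally show ?thesis .
  qed
  have "(\<lambda>t. measure_pmf.prob (P t) {G. c * ln (real t) \<le> real (diam G)}) \<longlonglongrightarrow> 1"
  proof (rule tendsto_sandwich)
    show "eventually (\<lambda>t. 1 - ?b t \<le> measure_pmf.prob (P t) {G. c * ln (real t) \<le> real (diam G)}) sequentially"
      using eventually_ge_at_top[of 3] by eventually_elim (rule lower)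
    show "(\<lambda>t. 1 - ?b t) \<longlonglongrightarrow> 1"
      using m by real_asymp
  qed auto
  then show ?thesis using pb by (intro exI[of _ c]) (auto simp: c_def with_high_probability_def)
qed

end

section \<open>The preferential attachment models\<close>

text \<open>A kernel that stays constant during a batch makes the draws of the batch independent.
  This embeds the simultaneous edges of model (c) into the sequential scheme.\<close>

lemma draws_add:
  assumes "\<And>xs us. xs \<in> set_pmf (draws K n) \<Longrightarrow> length us < q \<Longrightarrow> K (xs @ us) = K xs"
  shows "draws K (n + q) = do {xs \<leftarrow> draws K n; us \<leftarrow> replicate_pmf q (K xs); return_pmf (xs @ us)}"
proof -
  have "draws K (n + j) = do {xs \<leftarrow> draws K n; us \<leftarrow> replicate_pmf j (K xs); return_pmf (xs @ us)}"
    if "j \<le> q" for j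
    using that
  proof (induction j)
    case (Suc j)
    \<comment> \<open>\<open>replicate_pmf\<close> recurses at the front of the list, whereas
      \<open>draws\<close> appends at its end.\<close>
    have snoc: "replicate_pmf (Suc j) p = do {us \<leftarrow> replicate_pmf j p; i \<leftarrow> p; return_pmf (us @ [i])}" for p :: "'a pmf"
      using replicate_pmf_distrib[of j 1 p]
      by (simp add: replicate_pmf_1[unfolded One_nat_def] map_pmf_def bind_assoc_pmf bind_return_pmf)
    have "draws K (n + Suc j) = do {xs \<leftarrow> draws K n; us \<leftarrow> replicate_pmf j (K xs); i \<leftarrow> K (xs @ us); return_pmf (xs @ us @ [i])}"
      using Suc by (simp add: bind_assoc_pmf bind_return_pmf)
    also have "\<dots> = do {xs \<leftarrow> draws K n; us \<leftarrow> replicate_pmf j (K xs); i \<leftarrow> K xs; return_pmf (xs @ us @ [i])}"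
    proof (intro bind_pmf_cong refl)
      fix xs us assume "xs \<in> set_pmf (draws K n)" "us \<in> set_pmf (replicate_pmf j (K xs))"
      then have "K (xs @ us) = K xs" using Suc.prems by (intro assms) (auto simp: set_replicate_pmf)
      then show "K (xs @ us) = K xs" .
    qed
    also have "\<dots> = do {xs \<leftarrow> draws K n; us \<leftarrow> replicate_pmf (Suc j) (K xs); return_pmf (xs @ us)}"
      unfolding snoc by (simp add: bind_assoc_pmf bind_return_pmf)
    finally show ?case .
  qed (simp add: bind_return_pmf bind_return_pmf')
  then show ?thesis by simp
qed

section \<open>Graphs as functions of the draws\<close>

definition history_graph :: "nat \<Rightarrow> nat uprod multiset \<Rightarrow> nat \<Rightarrow> nat list \<Rightarrow> nat multigraph" where
  "history_graph t\<^sub>0 E q xs = Multigraph {1..t\<^sub>0 + length xs div q}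
     (E + mset (map (\<lambda>n. Upair (t\<^sub>0 + 1 + n div q) (xs ! n)) [0..<length xs]))"

lemma history_graph_append:
  assumes "q \<ge> 1" "length xs = q * s" "length us = q"
  shows "history_graph t\<^sub>0 E q (xs @ us) = add_vertex (t\<^sub>0 + s + 1) us (history_graph t\<^sub>0 E q xs)"
proof -
  have "map (\<lambda>n. Upair (t\<^sub>0 + 1 + n div q) ((xs @ us) ! n)) [0..<q * s + q]
     = map (\<lambda>n. Upair (t\<^sub>0 + 1 + n div q) (xs ! n)) [0..<q * s] @ map (Upair (t\<^sub>0 + s + 1)) us"
  proof (rule nth_equalityI)
    fix i assume "i < length (map (\<lambda>n. Upair (t\<^sub>0 + 1 + n div q) ((xs @ us) ! n)) [0..<q * s + q])"
    then have i: "i < q * s + q" by simp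
    have "i div q = s" if "\<not> i < q * s"
      using that i assms(1) by (intro div_nat_eqI) (auto simp: mult.commute)
    then show "map (\<lambda>n. Upair (t\<^sub>0 + 1 + n div q) ((xs @ us) ! n)) [0..<q * s + q] ! i =
      (map (\<lambda>n. Upair (t\<^sub>0 + 1 + n div q) (xs ! n)) [0..<q * s] @ map (Upair (t\<^sub>0 + s + 1)) us) ! i"
      using i assms by (auto simp: nth_append)
  qed (use assms in simp)
  moreover have "{1..t\<^sub>0 + Suc s} = insert (t\<^sub>0 + s + 1) {1..t\<^sub>0 + s}" by auto
  ultimately show ?thesis using assms by (simp add: history_graph_def add_vertex_def)
qed

lemma vdegree_map_Upair:
  "size {#e \<in># mset (map (\<lambda>n. Upair (f n) (g n)) ns). i \<in> set_uprod e#} + count (mset (map (\<lambda>n. Upair (f n) (g n)) ns)) (Upair i i)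
    = length (filter (\<lambda>n. f n = i) ns) + length (filter (\<lambda>n. g n = i) ns)"
  by (induction ns) auto

text \<open>An initial edge contributes at most 2, and the vertex sends out at most \<open>q\<close>
  edges; only the draws of \<open>i\<close> vary. A loop is counted once as sent and once as drawn,
  in accordance with \<open>vdegree\<close>.\<close>

lemma vdegree_history_graph_le:
  assumes "q \<ge> 1"
  shows "vdegree (history_graph t\<^sub>0 E q xs) i \<le> 2 * size E + q + count_list xs i"
proof -
  let ?F = "mset (map (\<lambda>n. Upair (t\<^sub>0 + 1 + n div q) (xs ! n)) [0..<length xs])"
  have "vdegree (history_graph t\<^sub>0 E q xs) i = (size {#e \<in># E. i \<in> set_uprod e#} + count E (Upair i i))
      + (size {#e \<in># ?F. i \<in> set_uprod e#} + count ?F (Upair i i))"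
    by (simp add: vdegree_def history_graph_def del: mset_map)
  also have "size {#e \<in># ?F. i \<in> set_uprod e#} + count ?F (Upair i i)
      = length (filter (\<lambda>n. t\<^sub>0 + 1 + n div q = i) [0..<length xs]) + length (filter (\<lambda>n. xs ! n = i) [0..<length xs])"
    by (rule vdegree_map_Upair)
  also have "length (filter (\<lambda>n. xs ! n = i) [0..<length xs]) = count_list xs i"
  proof -
    have "length (filter (\<lambda>n. xs ! n = i) [0..<length xs]) = length (filter (\<lambda>x. x = i) (map ((!) xs) [0..<length xs]))"
      by (simp add: filter_map comp_def)
    moreover have "filter (\<lambda>x. x = i) xs = filter ((=) i) xs" by (intro filter_cong) auto
    ultimately show ?thesis by (simp add: map_nth count_list_eq_length_filter)
  qed
  also have "length (filter (\<lambda>n. t\<^sub>0 + 1 + n div q = i) [0..<length xs]) \<le> q"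
  proof -
    have "length (filter (\<lambda>n. t\<^sub>0 + 1 + n div q = i) [0..<length xs])
        = card {n. n < length xs \<and> t\<^sub>0 + 1 + n div q = i}"
      by (subst distinct_card[symmetric]) (auto intro!: arg_cong[where f = card])
    also have "\<dots> \<le> card {q * (i - t\<^sub>0 - 1)..<q * (i - t\<^sub>0 - 1) + q}"
    proof (intro card_mono subsetI)
      fix n assume n: "n \<in> {n. n < length xs \<and> t\<^sub>0 + 1 + n div q = i}"
      have "q * (n div q) \<le> n \<and> n < q * (n div q) + q"
        using assms mod_less_divisor[of q n] mult_div_mod_eq[of q n] by linarith
      then show "n \<in> {q * (i - t\<^sub>0 - 1)..<q * (i - t\<^sub>0 - 1) + q}" using n by auto
    qed auto
    finally show ?thesis by simp
  qed
  also have "size {#e \<in># E. i \<in> set_uprod e#} + count E (Upair i i) \<le> size E + size E"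
    by (intro add_mono size_filter_mset_lesseq) (simp add: count_le_size)
  finally show ?thesis by simp
qed

section \<open>Blocks and merged probabilities\<close>

lemma block_bounds:
  assumes "b \<ge> 1"
  shows "v \<le> b * block b v" "b * block b v \<le> v + b - 1"
proof -
  show "b * block b v \<le> v + b - 1" by (simp add: block_def)
  have "v + b - 1 < b * block b v + b"
    using assms mod_less_divisor[of b "v + b - 1"] mult_div_mod_eq[of b "v + b - 1"]
    unfolding block_def by linarith
  then show "v \<le> b * block b v" by linarith
qed

lemma block_mono: "v \<le> w \<Longrightarrow> block b v \<le> block b w"
  unfolding block_def by (intro div_le_mono) simp

lemma block_pos: "b \<ge> 1 \<Longrightarrow> v \<ge> 1 \<Longrightarrow> block b v \<ge> 1"
  using block_bounds(1)[of b v] by (cases "block b v") auto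

lemma block_mult: "b \<ge> 1 \<Longrightarrow> block b (b * v) = v"
proof -
  assume b: "b \<ge> 1"
  have "b * block b (b * v) < b * Suc v" "b * v \<le> b * block b (b * v)"
    using block_bounds[OF b, of "b * v"] b by auto
  then show ?thesis using b by (simp only: mult_less_cancel1 mult_le_cancel1) simp
qed

lemma block_le: "b \<ge> 1 \<Longrightarrow> block b (b * t) = t \<Longrightarrow> v \<le> b * t \<Longrightarrow> block b v \<le> t"
  using block_mono by metis

lemma block_le_self: "b \<ge> 1 \<Longrightarrow> v \<ge> 1 \<Longrightarrow> block b v \<le> v"
  unfolding block_def using div_le_mono[of "v + b - 1" "v * b" b]
  by (cases v) (auto simp: algebra_simps)

lemma sum_count_list_fibre:
  assumes "finite {i. f i = a}"
  shows "(\<Sum>i | f i = a. count_list xs i) = count_list (map f xs) a"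
proof (induction xs)
  case (Cons x xs)
  have "(\<Sum>i | f i = a. count_list (x # xs) i) = (\<Sum>i | f i = a. count_list xs i + (if i = x then 1 else 0))"
    by (intro sum.cong) auto
  also have "\<dots> = count_list (map f xs) a + (if f x = a then 1 else 0)"
    using assms Cons by (simp add: sum.distrib sum.delta)
  finally show ?case by simp
qed simp

text \<open>A bound that is affine in the number of earlier picks survives merging: the constants of
  the at most \<open>b\<close> vertices of a block add up to \<open>b * D\<close>, their picks to
  the picks of the block.\<close>

lemma prob_block_le:
  assumes b: "b \<ge> 1" and D: "D \<ge> 0" and c: "c \<ge> 0"
    and p: "\<And>i. pmf p i \<le> c * (D + real (count_list xs i))"
  shows "measure_pmf.prob p {i. block b i = a} \<le> c * (real b * D + real (count_list (map (block b) xs) a))"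
proof -
  have sub: "{i. block b i = a} \<subseteq> {b * a + 1 - b..b * a}"
  proof
    fix i assume "i \<in> {i. block b i = a}"
    then show "i \<in> {b * a + 1 - b..b * a}" using block_bounds[OF b, of i] b by auto
  qed
  then have fin: "finite {i. block b i = a}" by (rule finite_subset) simp
  have "card {i. block b i = a} \<le> card {b * a + 1 - b..b * a}" using sub by (intro card_mono) auto
  also have "\<dots> \<le> b" using b by auto
  finally have card: "real (card {i. block b i = a}) \<le> real b" by (rule of_nat_mono)
  have "measure_pmf.prob p {i. block b i = a} = (\<Sum>i | block b i = a. pmf p i)"
    using fin by (rule measure_measure_pmf_finite)
  also have "\<dots> \<le> (\<Sum>i | block b i = a. c * (D + real (count_list xs i)))"
    by (intro sum_mono p)
  also have "\<dots> = c * (real (card {i. block b i = a}) * D + real (\<Sum>i | block b i = a. count_list xs i))"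
    by (simp add: sum_distrib_left[symmetric] sum.distrib)
  also have "\<dots> \<le> c * (real b * D + real (count_list (map (block b) xs) a))"
    unfolding sum_count_list_fibre[OF fin]
    using c D card by (intro mult_left_mono add_right_mono mult_right_mono) auto
  finally show ?thesis .
qed

lemma realizes_history_graph:
  assumes b: "b \<ge> 1" and q: "q \<ge> 1" and len: "length xs = q * s" "t\<^sub>0 + s = b * t"
    and E: "\<And>e. e \<in># E \<Longrightarrow> set_uprod e \<subseteq> {1, 2}"
  shows "realizes (block b) (\<lambda>n. block b (t\<^sub>0 + 1 + n div q)) t (q * s) xs (merge_blocks b (history_graph t\<^sub>0 E q xs))"
proof -
  have "block b ` {1..b * t} = {1..t}"
  proof
    show "block b ` {1..b * t} \<subseteq> {1..t}"
      using block_le[OF b block_mult[OF b]] block_pos[OF b] by auto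
    show "{1..t} \<subseteq> block b ` {1..b * t}"
    proof
      fix j assume "j \<in> {1..t}"
      then show "j \<in> block b ` {1..b * t}"
        using b block_mult[OF b, of j] by (intro image_eqI[of _ _ "b * j"]) auto
    qed
  qed
  then have verts: "verts (merge_blocks b (history_graph t\<^sub>0 E q xs)) = {1..t}"
    using len q by (simp add: merge_blocks_def history_graph_def)
  have small: "u \<le> 2 \<and> v \<le> 2" if "e \<in># E" "Upair u v = map_uprod (block b) e" for e u v
  proof -
    obtain x y where e: "e = Upair x y" by (cases e) auto
    then have "x \<in> {1, 2}" "y \<in> {1, 2}" using E[OF that(1)] by auto
    then have "block b x \<le> 2" "block b y \<le> 2"
      using block_le_self[OF b, of x] block_le_self[OF b, of y] by auto
    then show ?thesis using that(2) e by auto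
  qed
  have edges: "Upair u v \<in># edges (merge_blocks b (history_graph t\<^sub>0 E q xs)) \<longleftrightarrow>
      (\<exists>e\<in>#E. Upair u v = map_uprod (block b) e) \<or>
      (\<exists>n<q * s. Upair u v = Upair (block b (t\<^sub>0 + 1 + n div q)) (block b (xs ! n)))" for u v
    using len(1) by (auto simp: merge_blocks_def history_graph_def image_iff)
  show ?thesis unfolding realizes_def edges using verts small by blast
qed

section \<open>Draw kernels of the models\<close>

abbreviation initial_bc :: "nat \<Rightarrow> nat uprod multiset" where
  "initial_bc q \<equiv> replicate_mset (2 * q) (Upair 1 2)"

text \<open>All \<open>q\<close> edges of a step are drawn from the degrees at the beginning of the step.\<close>
definition kernel_bc :: "nat \<Rightarrow> real \<Rightarrow> nat list \<Rightarrow> nat pmf" where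
  "kernel_bc q \<delta> xs = attach q \<delta> (2 + length xs div q)
     (history_graph 2 (initial_bc q) q (take (q * (length xs div q)) xs))"

definition kernel_a :: "real \<Rightarrow> nat list \<Rightarrow> nat pmf" where
  "kernel_a \<delta> xs = attach_or_loop \<delta> (1 + length xs) (history_graph 1 {#Upair 1 1#} 1 xs)"

lemma PA_c_draws:
  assumes q: "q \<ge> 1"
  shows "PA_c q \<delta> (2 + s) = map_pmf (history_graph 2 (initial_bc q) q) (draws (kernel_bc q \<delta>) (q * s))"
proof (induction s)
  case 0
  have "history_graph 2 (initial_bc q) q [] = Multigraph {1, 2} (initial_bc q)"
    by (auto simp: history_graph_def)
  then show ?case by (simp add: numeral_2_eq_2)
next
  case (Suc s)
  let ?K = "kernel_bc q \<delta>" and ?h = "history_graph 2 (initial_bc q) q"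
  have K: "?K (xs @ us) = attach q \<delta> (2 + s) (?h xs)"
    if "xs \<in> set_pmf (draws ?K (q * s))" "length us < q" for xs us
  proof -
    have "length xs = q * s" using that(1) by (rule length_draws)
    moreover from this have "(length xs + length us) div q = s"
      using that(2) q by (intro div_nat_eqI) (auto simp: algebra_simps)
    ultimately show ?thesis by (simp add: kernel_bc_def)
  qed
  have K0: "?K xs = attach q \<delta> (2 + s) (?h xs)" if "xs \<in> set_pmf (draws ?K (q * s))" for xs
    using K[OF that, of "[]"] q by simp
  have "draws ?K (q * Suc s) = draws ?K (q * s + q)" by (simp add: add.commute)
  also have "\<dots> = do {xs \<leftarrow> draws ?K (q * s); us \<leftarrow> replicate_pmf q (?K xs); return_pmf (xs @ us)}"
    by (rule draws_add) (simp add: K K0)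
  finally have "map_pmf ?h (draws ?K (q * Suc s))
      = do {xs \<leftarrow> draws ?K (q * s); us \<leftarrow> replicate_pmf q (?K xs); return_pmf (?h (xs @ us))}"
    by (simp add: map_bind_pmf)
  also have "\<dots> = do {xs \<leftarrow> draws ?K (q * s); us \<leftarrow> replicate_pmf q (attach q \<delta> (2 + s) (?h xs));
      return_pmf (add_vertex (2 + s + 1) us (?h xs))}"
  proof (rule bind_pmf_cong[OF refl])
    fix xs assume xs: "xs \<in> set_pmf (draws ?K (q * s))"
    show "do {us \<leftarrow> replicate_pmf q (?K xs); return_pmf (?h (xs @ us))}
      = do {us \<leftarrow> replicate_pmf q (attach q \<delta> (2 + s) (?h xs)); return_pmf (add_vertex (2 + s + 1) us (?h xs))}"
      unfolding K0[OF xs]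
    proof (rule bind_pmf_cong[OF refl])
      fix us assume "us \<in> set_pmf (replicate_pmf q (attach q \<delta> (2 + s) (?h xs)))"
      then have "length us = q" by (simp add: set_replicate_pmf)
      then show "return_pmf (?h (xs @ us)) = return_pmf (add_vertex (2 + s + 1) us (?h xs))"
        using history_graph_append[OF q length_draws[OF xs]] by simp
    qed
  qed
  also have "\<dots> = PA_c q \<delta> (2 + Suc s)"
    using Suc by (simp add: bind_map_pmf)
  finally show ?case ..
qed

lemma PA_a1_draws:
  "PA_a1 \<delta> (1 + s) = map_pmf (history_graph 1 {#Upair 1 1#} 1) (draws (kernel_a \<delta>) s)"
proof (induction s)
  case 0
  then show ?case by (simp add: history_graph_def)
next
  case (Suc s)
  let ?K = "kernel_a \<delta>" and ?h = "history_graph 1 {#Upair 1 1#} 1"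
  have "map_pmf ?h (draws ?K (Suc s)) = do {xs \<leftarrow> draws ?K s; i \<leftarrow> ?K xs; return_pmf (?h (xs @ [i]))}"
    by (simp add: map_bind_pmf)
  also have "\<dots> = do {xs \<leftarrow> draws ?K s; i \<leftarrow> attach_or_loop \<delta> (1 + s) (?h xs); return_pmf (add_vertex (1 + s + 1) [i] (?h xs))}"
    using history_graph_append[of 1 _ s "[_]" 1 "{#Upair 1 1#}"] length_draws[of _ ?K s]
    by (intro bind_pmf_cong) (auto simp: kernel_a_def)
  also have "\<dots> = PA_a1 \<delta> (1 + Suc s)"
    using Suc by (simp add: bind_map_pmf)
  finally show ?case ..
qed

text \<open>The constant 5q is 4q from the initial edges plus q from the edges sent out. Degrees are
  frozen during a batch, so counting all draws only overestimates them. The kernel is known to be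
  given by its weights only on graphs that the process reaches, hence the assumption on
  \<open>xs\<close>.\<close>

lemma pmf_kernel_bc:
  assumes q: "q \<ge> 1" and \<delta>: "\<delta> > 0" and xs: "xs \<in> set_pmf (draws (kernel_bc q \<delta>) n)"
  shows "pmf (kernel_bc q \<delta> xs) i
      \<le> real q / (2 * real q + \<delta>) / real (n + 1) * (5 * real q + \<delta> + real (count_list xs i))"
    and "i \<in> set_pmf (kernel_bc q \<delta> xs) \<Longrightarrow> 1 \<le> i \<and> i \<le> 2 + n div q"
proof -
  let ?K = "kernel_bc q \<delta>" and ?h = "history_graph 2 (initial_bc q) q"
  define s where "s = n div q"
  define ys where "ys = take (q * s) xs"
  have len: "length xs = n" using xs by (rule length_draws)
  have "q * s \<le> n" by (simp add: s_def)
  then have "ys \<in> set_pmf (draws ?K (q * s))"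
    using draws_nth[OF xs, of "q * s"] xs len by (cases "q * s = n") (auto simp: ys_def)
  then have mem: "?h ys \<in> set_pmf (PA_c q \<delta> (2 + s))"
    unfolding PA_c_draws[OF q] by simp
  have G: "pa_graph q (2 + s) (?h ys)"
    using \<delta> by (intro pa_graph_PA_c[OF q _ _ mem]) auto
  have K: "?K xs = attach q \<delta> (2 + s) (?h ys)"
    by (simp add: kernel_bc_def len s_def ys_def)
  have pmf: "pmf (?K xs) i = (if i \<in> {1..2 + s} then (real (vdegree (?h ys) i) + \<delta>) / (real (2 + s) * (2 * real q + \<delta>)) else 0)"
    unfolding K using \<delta> by (intro pmf_attach G q) auto
  show "i \<in> set_pmf (?K xs) \<Longrightarrow> 1 \<le> i \<and> i \<le> 2 + n div q"
    using pmf by (auto simp: set_pmf_eq s_def split: if_splits)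
  have "n < q * (s + 1)"
    using q dividend_less_times_div[of q n] unfolding s_def by simp
  also have "\<dots> \<le> q * (2 + s)" by simp
  finally have "real (n + 1) \<le> real (q * (2 + s))" by (intro of_nat_mono) simp
  then have "real (n + 1) / real q \<le> real (2 + s)" using q by (simp add: field_simps)
  then have Z: "real (n + 1) / real q * (2 * real q + \<delta>) \<le> real (2 + s) * (2 * real q + \<delta>)"
    using \<delta> by (intro mult_right_mono) auto
  have "count_list xs i = count_list ys i + count_list (drop (q * s) xs) i"
    unfolding ys_def by (metis append_take_drop_id count_list_append)
  then have "vdegree (?h ys) i \<le> 5 * q + count_list xs i"
    using vdegree_history_graph_le[OF q, of 2 "initial_bc q" ys i] by simp
  then have "real (vdegree (?h ys) i) \<le> real (5 * q + count_list xs i)" by (rule of_nat_mono)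
  then have D: "real (vdegree (?h ys) i) + \<delta> \<le> 5 * real q + \<delta> + real (count_list xs i)" by simp
  have "pmf (?K xs) i \<le> (5 * real q + \<delta> + real (count_list xs i)) / (real (n + 1) / real q * (2 * real q + \<delta>))"
  proof -
    have Z0: "real (n + 1) / real q * (2 * real q + \<delta>) > 0"
      using q \<delta> by (intro mult_pos_pos divide_pos_pos) auto
    then have "(real (vdegree (?h ys) i) + \<delta>) / (real (2 + s) * (2 * real q + \<delta>))
        \<le> (5 * real q + \<delta> + real (count_list xs i)) / (real (n + 1) / real q * (2 * real q + \<delta>))"
      using \<delta> by (intro frac_le D Z) auto
    moreover have "0 \<le> (5 * real q + \<delta> + real (count_list xs i)) / (real (n + 1) / real q * (2 * real q + \<delta>))"
      using \<delta> Z0 by (intro divide_nonneg_pos) auto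
    ultimately show ?thesis unfolding pmf by (simp only: split: if_split) blast
  qed
  also have "\<dots> = real q / (2 * real q + \<delta>) / real (n + 1) * (5 * real q + \<delta> + real (count_list xs i))"
    by (simp add: mult.commute)
  finally show "pmf (?K xs) i
      \<le> real q / (2 * real q + \<delta>) / real (n + 1) * (5 * real q + \<delta> + real (count_list xs i))" .
qed

lemma pmf_kernel_a:
  assumes \<delta>: "\<delta> > 0" and xs: "xs \<in> set_pmf (draws (kernel_a \<delta>) n)"
  shows "pmf (kernel_a \<delta> xs) i \<le> 1 / (2 + \<delta>) / real (n + 1) * (3 + \<delta> + real (count_list xs i))"
    and "i \<in> set_pmf (kernel_a \<delta> xs) \<Longrightarrow> 1 \<le> i \<and> i \<le> n + 2"
proof -
  let ?K = "kernel_a \<delta>" and ?h = "history_graph 1 {#Upair 1 1#} 1"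
  let ?Z = "real (1 + n) * (2 + \<delta>) + (1 + \<delta>)"
  have len: "length xs = n" using xs by (rule length_draws)
  have mem: "?h xs \<in> set_pmf (PA_a1 \<delta> (1 + n))"
    unfolding PA_a1_draws using xs by simp
  have G: "pa_graph 1 (1 + n) (?h xs)"
    using \<delta> by (intro pa_graph_PA_a1[OF _ _ mem]) auto
  have pmf: "pmf (?K xs) i = (if i \<in> {1..1 + n} then (real (vdegree (?h xs) i) + \<delta>) / ?Z
     else if i = 1 + n + 1 then (1 + \<delta>) / ?Z else 0)"
    unfolding kernel_a_def len using \<delta> by (intro pmf_attach_or_loop G) auto
  show "i \<in> set_pmf (?K xs) \<Longrightarrow> 1 \<le> i \<and> i \<le> n + 2"
    using pmf by (auto simp: set_pmf_eq split: if_splits)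
  have "vdegree (?h xs) i \<le> 3 + count_list xs i"
    using vdegree_history_graph_le[of 1 1 "{#Upair 1 1#}" xs i] by simp
  then have "real (vdegree (?h xs) i) \<le> real (3 + count_list xs i)" by (rule of_nat_mono)
  then have D: "real (vdegree (?h xs) i) + \<delta> \<le> 3 + \<delta> + real (count_list xs i)" by simp
  have Z: "real (n + 1) * (2 + \<delta>) \<le> ?Z" using \<delta> by simp
  have Z0: "real (n + 1) * (2 + \<delta>) > 0" using \<delta> by simp
  have "pmf (?K xs) i \<le> (3 + \<delta> + real (count_list xs i)) / (real (n + 1) * (2 + \<delta>))"
  proof -
    have "(real (vdegree (?h xs) i) + \<delta>) / ?Z \<le> (3 + \<delta> + real (count_list xs i)) / (real (n + 1) * (2 + \<delta>))"
      using D Z Z0 \<delta> by (intro frac_le) auto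
    moreover have "(1 + \<delta>) / ?Z \<le> (3 + \<delta> + real (count_list xs i)) / (real (n + 1) * (2 + \<delta>))"
      using Z Z0 \<delta> by (intro frac_le) auto
    moreover have "0 \<le> (3 + \<delta> + real (count_list xs i)) / (real (n + 1) * (2 + \<delta>))"
      using \<delta> Z0 by auto
    ultimately show ?thesis unfolding pmf by (simp only: split: if_split) blast
  qed
  also have "\<dots> = 1 / (2 + \<delta>) / real (n + 1) * (3 + \<delta> + real (count_list xs i))"
    by simp
  finally show "pmf (?K xs) i \<le> 1 / (2 + \<delta>) / real (n + 1) * (3 + \<delta> + real (count_list xs i))" .
qed

text \<open>The offset t0 + 1 \<le> 3 and the rounding in \<open>block\<close> add at most 2 + b
  \<le> 3b, which is the origin of the slack in the locale.\<close>

lemma block_src_bounds: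
  assumes q: "q \<ge> 1" and b: "b \<ge> 1" and t\<^sub>0: "t\<^sub>0 \<le> 2"
  shows "n < q * b * block b (t\<^sub>0 + 1 + n div q)"
    and "q * b * block b (t\<^sub>0 + 1 + n div q) \<le> n + 3 * (q * b)"
proof -
  let ?v = "t\<^sub>0 + 1 + n div q"
  have n: "n < q * (n div q + 1)" "q * (n div q) \<le> n"
    using q dividend_less_times_div[of q n] by auto
  have "q * (n div q + 1) \<le> q * (b * block b ?v)"
    using block_bounds(1)[OF b, of ?v] by (intro mult_le_mono2) linarith
  then show "n < q * b * block b ?v" using n(1) by (simp add: mult.assoc)
  have "b * block b ?v \<le> n div q + 2 + b" using block_bounds(2)[OF b, of ?v] t\<^sub>0 by linarith
  also have "\<dots> \<le> n div q + 3 * b" using b by linarith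
  finally have "q * (b * block b ?v) \<le> q * (n div q + 3 * b)" by (rule mult_le_mono2)
  moreover have "q * (n div q + 3 * b) = q * (n div q) + 3 * (q * b)" by (simp add: algebra_simps)
  moreover have "q * (b * block b ?v) = q * b * block b ?v" by (rule mult.assoc[symmetric])
  ultimately show "q * b * block b ?v \<le> n + 3 * (q * b)" using n(2) by linarith
qed

lemma block_src_cover:
  assumes q: "q \<ge> 1" and b: "b \<ge> 1" and t\<^sub>0: "t\<^sub>0 \<le> 2" and v: "3 \<le> v" "v \<le> t"
  shows "\<exists>n<q * (b * t - t\<^sub>0). block b (t\<^sub>0 + 1 + n div q) = v"
proof (intro exI conjI)
  \<comment> \<open>The first draw of the last vertex \<open>b * v\<close> of block
    \<open>v\<close>; as v \<ge> 3, this vertex is not an initial one.\<close>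
  let ?n = "q * (b * v - (t\<^sub>0 + 1))"
  have "3 \<le> b * v" "b * v \<le> b * t" using b v by (auto intro: order_trans[OF v(1)])
  then have *: "t\<^sub>0 + 1 \<le> b * v" "b * v - (t\<^sub>0 + 1) < b * t - t\<^sub>0" using t\<^sub>0 by linarith+
  then show "?n < q * (b * t - t\<^sub>0)" using q by simp
  have "?n div q = b * v - (t\<^sub>0 + 1)" using q by simp
  then have "t\<^sub>0 + 1 + ?n div q = b * v" using * by linarith
  then show "block b (t\<^sub>0 + 1 + ?n div q) = v" by (simp only: block_mult[OF b])
qed

text \<open>Model (b) is q = 1 with blocks of size m and parameter \<delta>/m; model (c) is q = m
  with b = 1. Both lead to \<gamma> = 1/(2 + \<delta>/m).\<close>

lemma diam_whp_bc:
  assumes q: "q \<ge> 1" and b: "b \<ge> 1" and \<delta>: "\<delta> > 0"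
  shows "\<exists>c>0. with_high_probability (\<lambda>t. map_pmf (merge_blocks b) (PA_c q \<delta> (b * t)))
    (\<lambda>t G. c * ln (real t) \<le> real (diam G))"
proof -
  interpret attachment "kernel_bc q \<delta>" "block b" "\<lambda>n. block b (2 + 1 + n div q)" "q * b"
    "real q / (2 * real q + \<delta>)" "real b * (5 * real q + \<delta>)"
  proof
    show "0 < real q / (2 * real q + \<delta>)" "real q / (2 * real q + \<delta>) < 1 / 2"
      using q \<delta> by (auto simp: divide_simps)
    show "0 < real b * (5 * real q + \<delta>)" using b \<delta> by (auto intro!: mult_pos_pos add_nonneg_pos)
    show "1 \<le> q * b" using q b by simp
    show "n < q * b * block b (2 + 1 + n div q)" for n
      by (rule block_src_bounds(1)[OF q b]) simp
    show "q * b * block b (2 + 1 + n div q) \<le> n + 3 * (q * b)" for n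
      by (rule block_src_bounds(2)[OF q b]) simp
    fix xs n i a assume xs: "xs \<in> set_pmf (draws (kernel_bc q \<delta>) n)"
    show "1 \<le> block b i \<and> block b i \<le> block b (2 + 1 + n div q)" if "i \<in> set_pmf (kernel_bc q \<delta> xs)"
      using pmf_kernel_bc(2)[OF q \<delta> xs that] block_pos[OF b, of i] block_mono[of i "2 + 1 + n div q" b] by auto
    show "measure_pmf.prob (kernel_bc q \<delta> xs) {i. block b i = a}
      \<le> real q / (2 * real q + \<delta>) * (real b * (5 * real q + \<delta>) + real (count_list (map (block b) xs) a)) / real (n + 1)"
      using prob_block_le[OF b _ _ pmf_kernel_bc(1)[OF q \<delta> xs], of a] q \<delta> by simp
  qed
  show ?thesis
  proof (rule diam_whp)
    show "\<exists>n<q * (b * t - 2). block b (2 + 1 + n div q) = v" if "3 \<le> v" "v \<le> t" for t v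
      by (rule block_src_cover[OF q b _ that]) simp
    show "q * (b * t - 2) \<le> q * b * t" for t by (simp add: mult.assoc)
  next
    fix t :: nat assume t: "t \<ge> 3"
    then have "3 \<le> b * t" using b by (auto intro: order_trans[OF t])
    then have bt: "2 + (b * t - 2) = b * t" by simp
    show "map_pmf (merge_blocks b) (PA_c q \<delta> (b * t)) =
      map_pmf (\<lambda>xs. merge_blocks b (history_graph 2 (initial_bc q) q xs)) (draws (kernel_bc q \<delta>) (q * (b * t - 2)))"
      using PA_c_draws[OF q, of \<delta> "b * t - 2"] unfolding bt by (simp add: pmf.map_comp comp_def)
    fix xs assume "xs \<in> set_pmf (draws (kernel_bc q \<delta>) (q * (b * t - 2)))"
    then show "realizes (block b) (\<lambda>n. block b (2 + 1 + n div q)) t (q * (b * t - 2)) xs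
        (merge_blocks b (history_graph 2 (initial_bc q) q xs))"
      using bt by (intro realizes_history_graph b q length_draws) (auto split: if_splits)
  qed
qed

lemma diam_whp_a:
  assumes m: "m \<ge> 1" and \<delta>: "\<delta> > 0"
  shows "\<exists>c>0. with_high_probability (\<lambda>t. map_pmf (merge_blocks m) (PA_a1 \<delta> (m * t)))
    (\<lambda>t G. c * ln (real t) \<le> real (diam G))"
proof -
  \<comment> \<open>The unsimplified \<open>n div 1\<close> and \<open>1 * m\<close> keep the shape
    of the general statements about blocks at q = 1.\<close>
  interpret attachment "kernel_a \<delta>" "block m" "\<lambda>n. block m (1 + 1 + n div 1)" "1 * m"
    "1 / (2 + \<delta>)" "real m * (3 + \<delta>)"
  proof
    show "0 < 1 / (2 + \<delta>)" "1 / (2 + \<delta>) < 1 / 2"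
      using \<delta> by (auto simp: divide_simps)
    show "0 < real m * (3 + \<delta>)" using m \<delta> by auto
    show "1 \<le> 1 * m" using m by simp
    show "n < 1 * m * block m (1 + 1 + n div 1)" "1 * m * block m (1 + 1 + n div 1) \<le> n + 3 * (1 * m)" for n
      using block_src_bounds[OF _ m, of 1 1 n] by auto
    fix xs n i a assume xs: "xs \<in> set_pmf (draws (kernel_a \<delta>) n)"
    show "1 \<le> block m i \<and> block m i \<le> block m (1 + 1 + n div 1)" if "i \<in> set_pmf (kernel_a \<delta> xs)"
      using pmf_kernel_a(2)[OF \<delta> xs that] block_pos[OF m, of i] block_mono[of i "1 + 1 + n div 1" m] by auto
    show "measure_pmf.prob (kernel_a \<delta> xs) {i. block m i = a}
      \<le> 1 / (2 + \<delta>) * (real m * (3 + \<delta>) + real (count_list (map (block m) xs) a)) / real (n + 1)"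
      using prob_block_le[OF m _ _ pmf_kernel_a(1)[OF \<delta> xs], of a] \<delta> by simp
  qed
  show ?thesis
  proof (rule diam_whp)
    show "\<exists>n<1 * (m * t - 1). block m (1 + 1 + n div 1) = v" if "3 \<le> v" "v \<le> t" for t v
      using block_src_cover[OF _ m _ that, of 1 1] by simp
    show "1 * (m * t - 1) \<le> 1 * m * t" for t by simp
  next
    fix t :: nat assume t: "t \<ge> 3"
    then have "3 \<le> m * t" using m by (auto intro: order_trans[OF t])
    then have bt: "1 + (m * t - 1) = m * t" by simp
    show "map_pmf (merge_blocks m) (PA_a1 \<delta> (m * t)) =
      map_pmf (\<lambda>xs. merge_blocks m (history_graph 1 {#Upair 1 1#} 1 xs)) (draws (kernel_a \<delta>) (1 * (m * t - 1)))"
      using PA_a1_draws[of \<delta> "m * t - 1"] unfolding bt by (simp add: pmf.map_comp comp_def)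
    fix xs assume "xs \<in> set_pmf (draws (kernel_a \<delta>) (1 * (m * t - 1)))"
    then show "realizes (block m) (\<lambda>n. block m (1 + 1 + n div 1)) t (1 * (m * t - 1)) xs
        (merge_blocks m (history_graph 1 {#Upair 1 1#} 1 xs))"
      using bt length_draws m by (intro realizes_history_graph) auto
  qed
qed

lemma PA_b1_eq: "PA_b1 \<delta> s = PA_c 1 \<delta> s"
  by (induction s)
    (auto simp: replicate_pmf_1[unfolded One_nat_def] map_pmf_def bind_assoc_pmf
      bind_return_pmf numeral_2_eq_2)

theorem theorem1p4:
  fixes m :: nat and \<delta> :: real
  assumes "m \<ge> 1" and "\<delta> > 0"
  shows "\<forall>PA \<in> {PA_a, PA_b, PA_c}. \<exists>c\<^sub>2>0.
    with_high_probability (PA m \<delta>) (\<lambda>t G. real (diam G) \<ge> c\<^sub>2 * ln (real t))"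
proof -
  have \<delta>': "\<delta> / real m > 0" using assms by simp
  have "PA_a m \<delta> = (\<lambda>t. map_pmf (merge_blocks m) (PA_a1 (\<delta> / real m) (m * t)))"
    by (simp add: PA_a_def fun_eq_iff)
  moreover have "PA_b m \<delta> = (\<lambda>t. map_pmf (merge_blocks m) (PA_c 1 (\<delta> / real m) (m * t)))"
    by (simp add: PA_b_def PA_b1_eq fun_eq_iff)
  moreover have "PA_c m \<delta> = (\<lambda>t. map_pmf (merge_blocks 1) (PA_c m \<delta> (1 * t)))"
  proof -
    have "merge_blocks 1 = id" by (intro ext) (simp only: merge_blocks_1 id_apply)
    then show ?thesis by (simp only: pmf.map_id0 id_apply mult_1)
  qed
  ultimately show ?thesis
    using diam_whp_a[OF assms(1) \<delta>'] diam_whp_bc[OF _ assms(1) \<delta>', of 1] diam_whp_bc[OF assms(1) _ assms(2), of 1]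
    by (simp only: ball_simps) auto
qed

end
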